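(* Let $\Omega\subseteq\mathbb{H}^n$ be a domain and $u_1,\dots,u_n\in C^2(\Omega)$. Then for every $k=1,\dots,n$ the form $\triangle u_1\wedge\dots\wedge\triangle u_k$ is closed, i.e. $d_0(\triangle u_1\wedge\dots\wedge\triangle u_k)=0$ and $d_1(\triangle u_1\wedge\dots\wedge\triangle u_k)=0$ (derivatives of the merely continuous coefficients being taken in the sense of distributions).
   Context: Points of $\mathbb{H}^n\cong\mathbb{R}^{4n}$ are $q=(q_0,\dots,q_{n-1})$, $q_l=x_{4l}+\mathbf{i}x_{4l+1}+\mathbf{j}x_{4l+2}+\mathbf{k}x_{4l+3}$. Define complex first-order differential operators $\nabla_{j\alpha}$, $j=0,\dots,2n-1$, $\alpha=0,1$, by (here $\mathbf{i}$ is the imaginary unit of $\mathbb{C}$), for $l=0,\dots,n-1$: $\nabla_{(2l)0}=\partial_{x_{4l}}+\mathbf{i}\partial_{x_{4l+1}}$, $\nabla_{(2l)1}=-\partial_{x_{4l+2}}-\mathbf{i}\partial_{x_{4l+3}}$, $\nabla_{(2l+1)0}=\partial_{x_{4l+2}}-\mathbf{i}\partial_{x_{4l+3}}$, $\nabla_{(2l+1)1}=\partial_{x_{4l}}-\mathbf{i}\partial_{x_{4l+1}}$. Fix a basis $\{\omega^0,\dots,\omega^{2n-1}\}$ of $\mathbb{C}^{2n}$, $\omega^I=\omega^{i_1}\wedge\dots\wedge\omega^{i_p}$ for $I=(i_1,\dots,i_p)$. For $F=\sum_I f_I\omega^I$ with values in $\wedge^p\mathbb{C}^{2n}$, define $d_\alpha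 F=\sum_{k,I}\nabla_{k\alpha}f_I\,\omega^k\wedge\omega^I$, $\alpha=0,1$ (with distributional derivatives if the $f_I$ are not differentiable), and $\triangle F=d_0d_1F$. $F$ is closed if $d_0F=d_1F=0$. *)

theory Defs
  imports "HOL-Analysis.Analysis"
begin

section \<open>Coordinates and function spaces\<close>

text \<open>
  A quaternion \<open>x + iy + jz + kw\<close> is the vector of its components \<open>x, y, z, w\<close> at the
  indices \<open>0, 1, 2, 3\<close> of \<^typ>\<open>real^4\<close>, and the type below is \<open>H^n\<close> with \<open>n = CARD('n)\<close>.
\<close>

type_synonym 'n qspace = "(real^4)^'n"

text \<open>
  An enumeration \<open>e\<close> (a bijection from \<open>{..<CARD('n)}\<close> onto the index type) names the quaternionic
  coordinates \<open>q_l = q $ e l\<close>.  The real coordinate \<open>x_{4l+r}\<close> is then \<open>q $ e l $ of_nat r\<close>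
  for \<open>r < 4\<close>.
\<close>

definition coord_vec :: "(nat \<Rightarrow> 'n::finite) \<Rightarrow> nat \<Rightarrow> 'n qspace" where
  "coord_vec e i = axis (e (i div 4)) (axis (of_nat (i mod 4)) 1)"

definition dir_deriv :: "'a::euclidean_space \<Rightarrow> ('a \<Rightarrow> complex) \<Rightarrow> 'a \<Rightarrow> complex" where
  "dir_deriv b f q = frechet_derivative f (at q) b"

text \<open>\<open>C^k\<close> functions; meaningful for open \<open>\<Omega>\<close>.\<close>

primrec C_on :: "nat \<Rightarrow> 'a::euclidean_space set \<Rightarrow> ('a \<Rightarrow> complex) \<Rightarrow> bool" where
  "C_on 0 \<Omega> f \<longleftrightarrow> continuous_on \<Omega> f"
| "C_on (Suc k) \<Omega> f \<longleftrightarrow>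
     (\<forall>q\<in>\<Omega>. f differentiable (at q)) \<and> (\<forall>b\<in>Basis. C_on k \<Omega> (dir_deriv b f))"

definition test_functions :: "'a::euclidean_space set \<Rightarrow> ('a \<Rightarrow> complex) set" where
  "test_functions \<Omega> = {\<phi>. (\<forall>k. C_on k UNIV \<phi>) \<and>
     compact (closure {q. \<phi> q \<noteq> 0}) \<and> closure {q. \<phi> q \<noteq> 0} \<subseteq> \<Omega>}"

section \<open>The exterior algebra of \<open>\<complex>^{2n}\<close>\<close>

text \<open>
  An element \<open>\<Sum>\<^sub>I a\<^sub>I \<omega>^I\<close>, with \<open>I\<close> ranging over the strictly increasing multi-indices in
  \<open>0, \<dots>, 2n-1\<close>, is represented by its coefficients: \<open>I\<close> is identified with the set of its
  entries, and coefficients at other sets are \<open>0\<close>.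
\<close>

type_synonym ext = "nat set \<Rightarrow> complex"

definition omega :: "nat set \<Rightarrow> ext" where
  "omega I = (\<lambda>J. if J = I then 1 else 0)"

text \<open>For disjoint \<open>I\<close> and \<open>J\<close>: \<open>\<omega>^I \<and> \<omega>^J = shuffle_sign I J \<cdot> \<omega>^(I \<union> J)\<close>.\<close>

definition shuffle_sign :: "nat set \<Rightarrow> nat set \<Rightarrow> complex" where
  "shuffle_sign I J = (- 1) ^ card {(i, j). i \<in> I \<and> j \<in> J \<and> j < i}"

definition wedge :: "ext \<Rightarrow> ext \<Rightarrow> ext" (infixl "\<and>\<^sub>e" 70) where
  "(a \<and>\<^sub>e b) K = (\<Sum>I\<in>Pow K. shuffle_sign I (K - I) * a I * b (K - I))"

primrec wedge_upto :: "(nat \<Rightarrow> 'x \<Rightarrow> ext) \<Rightarrow> nat \<Rightarrow> 'x \<Rightarrow> ext" where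
  "wedge_upto F 0 = (\<lambda>q. omega {})"
| "wedge_upto F (Suc k) = (\<lambda>q. wedge_upto F k q \<and>\<^sub>e F (Suc k) q)"

section \<open>The operators \<open>\<nabla>\<^sub>j\<^sub>\<alpha>\<close> and \<open>d\<^sub>\<alpha>\<close>\<close>

text \<open>
  The parameter \<open>D\<close> provides the partial derivatives \<open>D i = \<partial>/\<partial>x\<^sub>i\<close>.  The definitions are used
  with \<open>'x\<close> the points (functions, classical derivatives) and with \<open>'x\<close> the test functions
  (distributions, distributional derivatives).
\<close>

definition nabla ::
  "(nat \<Rightarrow> ('x \<Rightarrow> complex) \<Rightarrow> 'x \<Rightarrow> complex) \<Rightarrow> nat \<Rightarrow> nat \<Rightarrow> ('x \<Rightarrow> complex) \<Rightarrow> 'x \<Rightarrow> complex" where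
  "nabla D j \<alpha> f x = (let l = j div 2 in
     if even j
     then (if \<alpha> = 0 then D (4*l) f x + \<i> * D (4*l+1) f x
                    else - D (4*l+2) f x - \<i> * D (4*l+3) f x)
     else (if \<alpha> = 0 then D (4*l+2) f x - \<i> * D (4*l+3) f x
                    else D (4*l) f x - \<i> * D (4*l+1) f x))"

definition d_gen ::
  "nat \<Rightarrow> (nat \<Rightarrow> ('x \<Rightarrow> complex) \<Rightarrow> 'x \<Rightarrow> complex) \<Rightarrow> nat \<Rightarrow> ('x \<Rightarrow> ext) \<Rightarrow> 'x \<Rightarrow> ext" where
  "d_gen n D \<alpha> F x = (\<lambda>J. \<Sum>k<2*n. \<Sum>I\<in>Pow {..<2*n}.
      nabla D k \<alpha> (\<lambda>y. F y I) x * (omega {k} \<and>\<^sub>e omega I) J)"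

definition d_classical ::
  "(nat \<Rightarrow> 'n::finite) \<Rightarrow> nat \<Rightarrow> ('n qspace \<Rightarrow> ext) \<Rightarrow> 'n qspace \<Rightarrow> ext" where
  "d_classical e = d_gen CARD('n) (\<lambda>i. dir_deriv (coord_vec e i))"

definition zero_form :: "('x \<Rightarrow> complex) \<Rightarrow> 'x \<Rightarrow> ext" where
  "zero_form u q = (\<lambda>I. u q * omega {} I)"

text \<open>The Baston operator \<open>\<triangle> = d\<^sub>0 d\<^sub>1\<close>.\<close>

definition baston ::
  "(nat \<Rightarrow> 'n::finite) \<Rightarrow> ('n qspace \<Rightarrow> complex) \<Rightarrow> 'n qspace \<Rightarrow> ext" where
  "baston e u = d_classical e 0 (d_classical e 1 (zero_form u))"

definition form_distribution ::
  "'a::euclidean_space set \<Rightarrow> ('a \<Rightarrow> ext) \<Rightarrow> ('a \<Rightarrow> complex) \<Rightarrow> ext" where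
  "form_distribution \<Omega> F \<phi> = (\<lambda>I. LINT q:\<Omega>|lborel. F q I * \<phi> q)"

definition distr_partial ::
  "(nat \<Rightarrow> 'n::finite) \<Rightarrow> nat \<Rightarrow>
     (('n qspace \<Rightarrow> complex) \<Rightarrow> complex) \<Rightarrow> ('n qspace \<Rightarrow> complex) \<Rightarrow> complex" where
  "distr_partial e i T \<phi> = - T (dir_deriv (coord_vec e i) \<phi>)"

definition d_distr ::
  "(nat \<Rightarrow> 'n::finite) \<Rightarrow> 'n qspace set \<Rightarrow> nat \<Rightarrow>
     ('n qspace \<Rightarrow> ext) \<Rightarrow> ('n qspace \<Rightarrow> complex) \<Rightarrow> ext" where
  "d_distr e \<Omega> \<alpha> F = d_gen CARD('n) (distr_partial e) \<alpha> (form_distribution \<Omega> F)"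

definition d_distr_vanishes ::
  "(nat \<Rightarrow> 'n::finite) \<Rightarrow> 'n qspace set \<Rightarrow> nat \<Rightarrow> ('n qspace \<Rightarrow> ext) \<Rightarrow> bool" where
  "d_distr_vanishes e \<Omega> \<alpha> F \<longleftrightarrow> (\<forall>\<phi>\<in>test_functions \<Omega>. \<forall>J. d_distr e \<Omega> \<alpha> F \<phi> J = 0)"

end

theory Submission
  imports Defs
begin

text \<open>
  If the \<open>u\<^sub>i\<close> were smooth, closedness would follow from the Leibniz rule together with
  \<open>d\<^sub>0\<^sup>2 = d\<^sub>1\<^sup>2 = 0\<close> and \<open>d\<^sub>0 d\<^sub>1 = - d\<^sub>1 d\<^sub>0\<close>.  For \<open>u\<^sub>i\<close> of class \<open>C^2\<close> the form has merely continuous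
  coefficients, and the argument is an induction on the number of factors in which all
  derivatives are moved to the test function.

  Let \<open>F\<close> be a form with continuous coefficients that is closed in the sense that the integral of
  \<open>d\<^sub>\<beta> \<psi> \<and> F\<close> vanishes for every \<open>\<psi>\<close> of class \<open>C^1\<close> with compact support, for \<open>\<beta> = 0\<close> and
  \<open>\<beta> = 1\<close>.  For a test function \<open>\<phi>\<close> of class \<open>C^2\<close> one has
  \<open>d\<^sub>0\<phi> \<and> \<triangle>u \<and> F = d\<^sub>0\<phi> \<and> d\<^sub>0d\<^sub>1u \<and> F = - d\<^sub>0(d\<^sub>0\<phi> \<and> d\<^sub>1u) \<and> F\<close>
  because \<open>d\<^sub>0 d\<^sub>0 \<phi> = 0\<close>.  The coefficients of \<open>d\<^sub>0\<phi> \<and> d\<^sub>1u\<close> are products of first derivatives of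
  \<open>C^2\<close> functions, hence \<open>C^1\<close> functions with compact support, so that the integral of the right-hand
  side vanishes since \<open>F\<close> is closed (\<open>d_wedge_d_d\<close> and \<open>integral_d_wedge_d_d_eq_0\<close>).  The case of
  \<open>d\<^sub>1\<close> is the same after writing \<open>\<triangle>u = - d\<^sub>1 d\<^sub>0 u\<close>.  This shows that \<open>\<triangle>u \<and> F\<close> is closed
  against \<open>C^2\<close> test functions.

  To close the induction, closedness against \<open>C^2\<close> test functions has to imply closedness against
  \<open>C^1\<close> test functions (\<open>vanishes_on_C1_if_on_C2\<close>).  Here a test function is smoothed by
  averaging it over short segments: the average over segments parallel to the basis vector \<open>b\<close>
  has a partial derivative in direction \<open>b\<close> that is a difference quotient, hence as smooth as the
  function itself.  Averaging along all basis vectors in turn leads from \<open>C^1\<close> to \<open>C^2\<close>, and each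
  averaging step changes the first derivatives by arbitrarily little.

  The induction starts with the constant form \<open>1\<close>, for which closedness says that the integral
  of a partial derivative of a compactly supported \<open>C^1\<close> function is \<open>0\<close>.  The symmetry of second
  derivatives, on which \<open>d\<^sub>\<alpha>\<^sup>2 = 0\<close> and \<open>d\<^sub>0 d\<^sub>1 = - d\<^sub>1 d\<^sub>0\<close> rest, is \<open>dir_deriv_commute\<close>.
\<close>

section \<open>The exterior algebra\<close>

lemma wedge_infinite: "infinite K \<Longrightarrow> (a \<and>\<^sub>e b) K = 0"
  by (simp add: wedge_def)

lemma wedge_sum_left:
  "(\<lambda>J. \<Sum>s\<in>S. c s * a s J) \<and>\<^sub>e b = (\<lambda>J. \<Sum>s\<in>S. c s * (a s \<and>\<^sub>e b) J)"
  unfolding wedge_def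
  by (rule ext, simp add: sum_distrib_left sum_distrib_right, subst sum.swap) (simp add: mult_ac)

lemma wedge_sum_right:
  "b \<and>\<^sub>e (\<lambda>J. \<Sum>s\<in>S. c s * a s J) = (\<lambda>J. \<Sum>s\<in>S. c s * (b \<and>\<^sub>e a s) J)"
  unfolding wedge_def
  by (rule ext, simp add: sum_distrib_left sum_distrib_right, subst sum.swap) (simp add: mult_ac)

lemma wedge_minus_left: "(\<lambda>J. - a J) \<and>\<^sub>e b = (\<lambda>J. - (a \<and>\<^sub>e b) J)"
  by (rule ext) (simp add: wedge_def sum_negf)

lemma wedge_minus_right: "a \<and>\<^sub>e (\<lambda>J. - b J) = (\<lambda>J. - (a \<and>\<^sub>e b) J)"
  by (rule ext) (simp add: wedge_def sum_negf)

text \<open>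
  The inversions of the pair \<open>(I \<union> I', J)\<close> split into those of \<open>(I, J)\<close> and those of \<open>(I', J)\<close>, so
  shuffle signs are multiplicative; this is what makes the wedge product associative.
\<close>

lemma shuffle_sign_Un_left:
  assumes "finite I" "finite I'" "finite J" "I \<inter> I' = {}"
  shows "shuffle_sign (I \<union> I') J = shuffle_sign I J * shuffle_sign I' J"
proof -
  have fin: "finite {(i, j). i \<in> A \<and> j \<in> J \<and> j < i}" if "finite A" for A
    by (rule finite_subset[of _ "A \<times> J"]) (use that assms in auto)
  have "{(i, j). i \<in> I \<union> I' \<and> j \<in> J \<and> j < i}
      = {(i, j). i \<in> I \<and> j \<in> J \<and> j < i} \<union> {(i, j). i \<in> I' \<and> j \<in> J \<and> j < i}"
    by auto
  then show ?thesis
    unfolding shuffle_sign_def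
    by (simp add: power_add[symmetric])
       (subst card_Un_disjoint, use fin assms in \<open>auto simp: disjoint_iff\<close>)
qed

lemma shuffle_sign_Un_right:
  assumes "finite I" "finite J" "finite J'" "J \<inter> J' = {}"
  shows "shuffle_sign I (J \<union> J') = shuffle_sign I J * shuffle_sign I J'"
proof -
  have fin: "finite {(i, j). i \<in> I \<and> j \<in> A \<and> j < i}" if "finite A" for A
    by (rule finite_subset[of _ "I \<times> A"]) (use that assms in auto)
  have "{(i, j). i \<in> I \<and> j \<in> J \<union> J' \<and> j < i}
      = {(i, j). i \<in> I \<and> j \<in> J \<and> j < i} \<union> {(i, j). i \<in> I \<and> j \<in> J' \<and> j < i}"
    by auto
  then show ?thesis
    unfolding shuffle_sign_def
    by (simp add: power_add[symmetric])
       (subst card_Un_disjoint, use fin assms in \<open>auto simp: disjoint_iff\<close>)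
qed

text \<open>
  Both sides are sums over the decompositions of \<open>K\<close> into three disjoint blocks.  The left-hand
  side is parametrized by the union \<open>M\<close> of the first two blocks and the first block \<open>I\<close>, the right-hand
  side by the first block \<open>I\<close> and the second block \<open>M - I\<close>.
\<close>

lemma wedge_assoc: "(a \<and>\<^sub>e b) \<and>\<^sub>e c = a \<and>\<^sub>e (b \<and>\<^sub>e c)"
proof
  fix K
  show "((a \<and>\<^sub>e b) \<and>\<^sub>e c) K = (a \<and>\<^sub>e (b \<and>\<^sub>e c)) K"
  proof (cases "finite K")
    case False
    then show ?thesis by (simp add: wedge_infinite)
  next
    case True
    have fin: "finite A" if "A \<subseteq> K" for A
      using True that by (rule rev_finite_subset)
    \<comment> \<open>Both sides are the product of the three signs of pairs of blocks.\<close>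
    have sign: "shuffle_sign M (K - M) * shuffle_sign I (M - I)
        = shuffle_sign I (K - I) * shuffle_sign (M - I) (K - M)" if "I \<subseteq> M" "M \<subseteq> K" for I M
    proof -
      have M: "M = I \<union> (M - I)" and KI: "K - I = (M - I) \<union> (K - M)" using that by auto
      have "shuffle_sign M (K - M) = shuffle_sign I (K - M) * shuffle_sign (M - I) (K - M)"
        by (subst M, rule shuffle_sign_Un_left) (use that fin in auto)
      moreover have "shuffle_sign I (K - I) = shuffle_sign I (M - I) * shuffle_sign I (K - M)"
        by (subst KI, rule shuffle_sign_Un_right) (use that fin in auto)
      ultimately show ?thesis by simp
    qed
    have "((a \<and>\<^sub>e b) \<and>\<^sub>e c) K = (\<Sum>M\<in>Pow K. \<Sum>I\<in>Pow M.
        shuffle_sign M (K - M) * shuffle_sign I (M - I) * (a I * b (M - I) * c (K - M)))"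
      by (simp add: wedge_def sum_distrib_left sum_distrib_right mult_ac)
    also have "\<dots> = (\<Sum>(M, I)\<in>(SIGMA M:Pow K. Pow M).
        shuffle_sign M (K - M) * shuffle_sign I (M - I) * (a I * b (M - I) * c (K - M)))"
      by (subst sum.Sigma) (use fin True in auto)
    also have "\<dots> = (\<Sum>(I, J)\<in>(SIGMA I:Pow K. Pow (K - I)).
        shuffle_sign I (K - I) * shuffle_sign J (K - I - J) * (a I * b J * c (K - I - J)))"
    proof -
      have main: "shuffle_sign I (K - I) * shuffle_sign (M - I) (K - I - (M - I)) *
            (a I * b (M - I) * c (K - I - (M - I)))
          = shuffle_sign M (K - M) * shuffle_sign I (M - I) * (a I * b (M - I) * c (K - M))"
        if MI: "I \<subseteq> M" "M \<subseteq> K" for M I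
      proof -
        have "K - I - (M - I) = K - M" using MI by auto
        with sign[OF MI] show ?thesis by simp
      qed
      show ?thesis
      proof (rule sum.reindex_bij_witness[where i = "\<lambda>(I, J). (I \<union> J, I)" and j = "\<lambda>(M, I). (I, M - I)"], goal_cases)
        case (5 p)
        then obtain M I where p: "p = (M, I)" and "I \<subseteq> M" "M \<subseteq> K" by auto
        from main[OF this(2,3)] show ?case unfolding p prod.case .
      qed auto
    qed
    also have "\<dots> = (\<Sum>I\<in>Pow K. \<Sum>J\<in>Pow (K - I).
        shuffle_sign I (K - I) * shuffle_sign J (K - I - J) * (a I * b J * c (K - I - J)))"
      by (subst sum.Sigma) (use fin True in auto)
    also have "\<dots> = (a \<and>\<^sub>e (b \<and>\<^sub>e c)) K"
      by (simp add: wedge_def sum_distrib_left sum_distrib_right mult_ac)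
    finally show ?thesis .
  qed
qed

text \<open>
  Each pair in \<open>I \<times> J\<close> is an inversion of exactly one of \<open>(I, J)\<close> and \<open>(J, I)\<close>.
\<close>

lemma shuffle_sign_commute:
  assumes "finite I" "finite J" "I \<inter> J = {}"
  shows "shuffle_sign J I = (- 1) ^ (card I * card J) * shuffle_sign I J"
proof -
  let ?A = "{(i, j). i \<in> I \<and> j \<in> J \<and> j < i}" and ?B = "{(j, i). j \<in> J \<and> i \<in> I \<and> i < j}"
  have "I \<times> J = ?A \<union> prod.swap ` ?B"
    using assms(3) by (auto simp: image_iff)
  moreover have "card (?A \<union> prod.swap ` ?B) = card ?A + card (prod.swap ` ?B)"
  proof (rule card_Un_disjoint)
    show "finite ?A" "finite (prod.swap ` ?B)"
      by (rule finite_subset[of _ "I \<times> J"], use assms in auto)+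
  qed auto
  moreover have "card (prod.swap ` ?B) = card ?B"
    by (rule card_image) auto
  ultimately have "card I * card J = card ?A + card ?B"
    by (simp add: card_cartesian_product[symmetric] del: card_cartesian_product)
  moreover have "(- 1) ^ (p + q) * (- 1) ^ p = (- 1 :: complex) ^ q" for p q
    by (induction p) auto
  ultimately show ?thesis
    by (simp only: shuffle_sign_def)
qed

lemma wedge_commute_even:
  assumes "\<And>J. b J \<noteq> 0 \<Longrightarrow> even (card J)"
  shows "a \<and>\<^sub>e b = b \<and>\<^sub>e a"
proof
  fix K
  show "(a \<and>\<^sub>e b) K = (b \<and>\<^sub>e a) K"
  proof (cases "finite K")
    case True
    have "shuffle_sign I (K - I) * b (K - I) = shuffle_sign (K - I) I * b (K - I)"
      if "I \<in> Pow K" for I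
    proof (cases "b (K - I) = 0")
      case False
      with shuffle_sign_commute[of I "K - I"] True that assms show ?thesis
        by (simp add: finite_subset)
    qed simp
    then have "(a \<and>\<^sub>e b) K = (\<Sum>I\<in>Pow K. shuffle_sign (K - I) I * b (K - I) * a I)"
      unfolding wedge_def by (intro sum.cong) (simp_all add: mult_ac)
    also have "\<dots> = (b \<and>\<^sub>e a) K"
      unfolding wedge_def
      by (rule sum.reindex_bij_witness[where i = "\<lambda>I. K - I" and j = "\<lambda>I. K - I"])
         (auto simp: double_diff)
    finally show ?thesis .
  qed (simp add: wedge_infinite)
qed

lemma omega_apply: "omega I J = (if J = I then 1 else 0)"
  by (simp add: omega_def)

lemma wedge_omega:
  "(omega I \<and>\<^sub>e omega J) K = (if finite K \<and> I \<inter> J = {} \<and> K = I \<union> J then shuffle_sign I J else 0)"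
proof (cases "finite K")
  case True
  have "(omega I \<and>\<^sub>e omega J) K = (\<Sum>A\<in>Pow K. if A = I then shuffle_sign I (K - I) * omega J (K - I) else 0)"
    unfolding wedge_def by (intro sum.cong) (auto simp: omega_def)
  also have "\<dots> = (if I \<subseteq> K then shuffle_sign I (K - I) * omega J (K - I) else 0)"
    using True by (simp add: sum.delta')
  also have "\<dots> = (if I \<inter> J = {} \<and> K = I \<union> J then shuffle_sign I J else 0)"
    by (auto simp: omega_def Un_Diff)
  finally show ?thesis using True by simp
qed (simp add: wedge_infinite)

lemma wedge_omega_empty: "(omega {k} \<and>\<^sub>e omega {}) J = omega {k} J"
  unfolding wedge_omega by (auto simp: omega_def shuffle_sign_def)

lemma omega_anticommute: "omega {i} \<and>\<^sub>e omega {j} = (\<lambda>K. - (omega {j} \<and>\<^sub>e omega {i}) K)"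
proof
  fix K
  show "(omega {i} \<and>\<^sub>e omega {j}) K = - (omega {j} \<and>\<^sub>e omega {i}) K"
    using shuffle_sign_commute[of "{i}" "{j}"]
    by (cases "i = j") (auto simp: wedge_omega insert_commute)
qed

lemma omega_wedge_left_commute:
  "omega {i} \<and>\<^sub>e (omega {j} \<and>\<^sub>e a) = (\<lambda>J. - (omega {j} \<and>\<^sub>e (omega {i} \<and>\<^sub>e a)) J)"
  unfolding wedge_assoc[symmetric] by (subst omega_anticommute) (rule wedge_minus_left)

text \<open>
  The expansion of the second factor into basis forms, in the shape in which it occurs in the
  definition of \<open>d\<^sub>\<alpha>\<close>.  It suffices to sum over \<open>I \<subseteq> S\<close>, because only \<open>I \<subseteq> J\<close> contribute at \<open>J\<close>.
\<close>

lemma wedge_eq_sum_omega: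
  assumes "finite S" "J \<subseteq> S"
  shows "(a \<and>\<^sub>e b) J = (\<Sum>I\<in>Pow S. b I * (a \<and>\<^sub>e omega I) J)"
proof -
  have fin: "finite J" using assms by (rule rev_finite_subset)
  have "(\<Sum>I\<in>Pow S. b I * (a \<and>\<^sub>e omega I) J)
      = (\<Sum>A\<in>Pow J. shuffle_sign A (J - A) * a A * (\<Sum>I\<in>Pow S. if J - A = I then b I else 0))"
    unfolding wedge_def omega_def sum_distrib_left
    by (subst sum.swap) (intro sum.cong, auto)
  also have "\<dots> = (a \<and>\<^sub>e b) J"
    unfolding wedge_def using assms by (intro sum.cong) (auto simp: sum.delta)
  finally show ?thesis by simp
qed

section \<open>Functions of class C1 and C2\<close>

lemma dir_deriv_eq: "(f has_derivative f') (at q) \<Longrightarrow> dir_deriv b f q = f' b"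
  unfolding dir_deriv_def using frechet_derivative_at by metis

lemma has_derivative_dir_deriv:
  "f differentiable (at q) \<Longrightarrow> (f has_derivative (\<lambda>v. dir_deriv v f q)) (at q)"
  unfolding dir_deriv_def using frechet_derivative_works by (metis eta_contract_eq)

lemma dir_deriv_const: "dir_deriv b (\<lambda>x. c) q = 0"
  by (rule dir_deriv_eq) (rule has_derivative_const)

lemma dir_deriv_add:
  "f differentiable (at q) \<Longrightarrow> g differentiable (at q) \<Longrightarrow>
    dir_deriv b (\<lambda>x. f x + g x) q = dir_deriv b f q + dir_deriv b g q"
  by (rule dir_deriv_eq) (rule has_derivative_add; erule has_derivative_dir_deriv)

lemma dir_deriv_mult:
  "f differentiable (at q) \<Longrightarrow> g differentiable (at q) \<Longrightarrow>
    dir_deriv b (\<lambda>x. f x * g x) q = f q * dir_deriv b g q + dir_deriv b f q * g q"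
  by (rule dir_deriv_eq) (rule has_derivative_mult; erule has_derivative_dir_deriv)

lemma dir_deriv_cmult:
  "f differentiable (at q) \<Longrightarrow> dir_deriv b (\<lambda>x. c * f x) q = c * dir_deriv b f q"
  by (simp add: dir_deriv_mult dir_deriv_const)

lemma dir_deriv_cong_open:
  assumes "open S" "q \<in> S" "\<And>x. x \<in> S \<Longrightarrow> f x = g x"
  shows "dir_deriv b f q = dir_deriv b g q"
proof -
  have "(f has_derivative f') (at q) \<longleftrightarrow> (g has_derivative f') (at q)" for f'
    using has_derivative_transform_within_open[OF _ assms(1,2)] assms(3) by metis
  then show ?thesis by (simp add: dir_deriv_def frechet_derivative_def)
qed

lemma C_on_1: "C_on 1 \<Omega> f \<longleftrightarrow>
    (\<forall>q\<in>\<Omega>. f differentiable (at q)) \<and> (\<forall>b\<in>Basis. continuous_on \<Omega> (dir_deriv b f))"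
  by simp

lemma C_on_2: "C_on 2 \<Omega> f \<longleftrightarrow>
    (\<forall>q\<in>\<Omega>. f differentiable (at q)) \<and> (\<forall>b\<in>Basis. C_on 1 \<Omega> (dir_deriv b f))"
  by (simp add: numeral_2_eq_2)

lemma C_on_1_continuous: "C_on 1 \<Omega> f \<Longrightarrow> continuous_on \<Omega> f"
  unfolding C_on_1 by (meson continuous_at_imp_continuous_on differentiable_imp_continuous_within)

lemma C_on_2_imp_1: "C_on 2 \<Omega> f \<Longrightarrow> C_on 1 \<Omega> f"
  using C_on_1_continuous unfolding C_on_2 C_on_1 by blast

text \<open>
  The description of \<open>C^1\<close> functions by a continuous derivative with values in the space of
  bounded linear maps, as needed for differentiating under the integral sign.
\<close>

lemma C_on_1_derivative:
  assumes "C_on 1 \<Omega> f"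
  obtains Df :: "'a::euclidean_space \<Rightarrow> 'a \<Rightarrow>\<^sub>L complex"
  where "\<And>x. x \<in> \<Omega> \<Longrightarrow> (f has_derivative Df x) (at x)" "continuous_on \<Omega> Df"
proof -
  define Df where "Df x = Blinfun (\<lambda>v. dir_deriv v f x)" for x
  have der: "(f has_derivative (\<lambda>v. dir_deriv v f x)) (at x)" if "x \<in> \<Omega>" for x
    using assms that has_derivative_dir_deriv unfolding C_on_1 by blast
  have Df: "blinfun_apply (Df x) = (\<lambda>v. dir_deriv v f x)" if "x \<in> \<Omega>" for x
    unfolding Df_def using has_derivative_bounded_linear[OF der[OF that]]
    by (rule bounded_linear_Blinfun_apply)
  show thesis
  proof (rule that)
    show "(f has_derivative Df x) (at x)" if "x \<in> \<Omega>" for x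
      using der Df that by simp
    show "continuous_on \<Omega> Df"
    proof (rule continuous_on_blinfun_componentwise)
      fix b :: 'a assume "b \<in> Basis"
      with assms have "continuous_on \<Omega> (dir_deriv b f)" unfolding C_on_1 by blast
      then show "continuous_on \<Omega> (\<lambda>x. Df x b)"
        by (rule continuous_on_eq) (simp add: Df)
    qed
  qed
qed

lemma C_on_1I:
  assumes "\<And>x. x \<in> \<Omega> \<Longrightarrow> (f has_derivative blinfun_apply (Df x)) (at x)" "continuous_on \<Omega> Df"
  shows "C_on 1 \<Omega> f"
  unfolding C_on_1
proof (intro conjI ballI)
  show "f differentiable (at q)" if "q \<in> \<Omega>" for q
    using assms(1)[OF that] by (rule differentiableI)
  fix b :: 'a
  have "continuous_on \<Omega> (\<lambda>x. Df x b)"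
    using assms(2) by (intro continuous_intros)
  then show "continuous_on \<Omega> (dir_deriv b f)"
    by (rule continuous_on_eq) (simp add: dir_deriv_eq[OF assms(1)])
qed

lemma C_on_1_cong_open:
  assumes "open \<Omega>" "\<And>x. x \<in> \<Omega> \<Longrightarrow> f x = g x" "C_on 1 \<Omega> f"
  shows "C_on 1 \<Omega> g"
proof -
  obtain Df :: "'a \<Rightarrow> 'a \<Rightarrow>\<^sub>L complex"
    where "\<And>x. x \<in> \<Omega> \<Longrightarrow> (f has_derivative Df x) (at x)" "continuous_on \<Omega> Df"
    using C_on_1_derivative[OF assms(3)] by blast
  then show ?thesis
    using has_derivative_transform_within_open[OF _ assms(1)] assms(2) by (intro C_on_1I) blast+
qed

lemma C_on_1_const: "C_on 1 \<Omega> (\<lambda>x. c)"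
  unfolding C_on_1 dir_deriv_const[abs_def] by simp

lemma C_on_1_add: 
  assumes "C_on 1 \<Omega> f" "C_on 1 \<Omega> g" shows "C_on 1 \<Omega> (\<lambda>x. f x + g x)"
  unfolding C_on_1
proof (intro conjI ballI)
  have d: "f differentiable (at q)" "g differentiable (at q)" if "q \<in> \<Omega>" for q
    using assms that unfolding C_on_1 by blast+
  then show "(\<lambda>x. f x + g x) differentiable (at q)" if "q \<in> \<Omega>" for q
    using that by simp
  fix b :: 'a assume "b \<in> Basis"
  with assms have "continuous_on \<Omega> (\<lambda>x. dir_deriv b f x + dir_deriv b g x)"
    unfolding C_on_1 by (intro continuous_intros) blast+
  then show "continuous_on \<Omega> (dir_deriv b (\<lambda>x. f x + g x))"
    by (rule continuous_on_eq) (simp add: dir_deriv_add d)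
qed

lemma C_on_1_mult: 
  assumes "C_on 1 \<Omega> f" "C_on 1 \<Omega> g" shows "C_on 1 \<Omega> (\<lambda>x. f x * g x)"
  unfolding C_on_1
proof (intro conjI ballI)
  have d: "f differentiable (at q)" "g differentiable (at q)" if "q \<in> \<Omega>" for q
    using assms that unfolding C_on_1 by blast+
  then show "(\<lambda>x. f x * g x) differentiable (at q)" if "q \<in> \<Omega>" for q
    using that by simp
  fix b :: 'a assume "b \<in> Basis"
  with assms C_on_1_continuous[OF assms(1)] C_on_1_continuous[OF assms(2)]
  have "continuous_on \<Omega> (\<lambda>x. f x * dir_deriv b g x + dir_deriv b f x * g x)"
    unfolding C_on_1 by (intro continuous_intros) blast+
  then show "continuous_on \<Omega> (dir_deriv b (\<lambda>x. f x * g x))"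
    by (rule continuous_on_eq) (simp add: dir_deriv_mult d)
qed

text \<open>
  Two applications of the mean value theorem, first in direction \<open>a\<close> to the difference of \<open>f\<close> in
  direction \<open>b\<close>, then in direction \<open>b\<close> to the derivative in direction \<open>a\<close>.
\<close>

lemma second_difference_mvt:
  fixes f :: "'a::real_normed_vector \<Rightarrow> real"
  assumes f: "\<And>x. x \<in> \<Omega> \<Longrightarrow> (f has_derivative f' x) (at x)"
    and fa: "\<And>x. x \<in> \<Omega> \<Longrightarrow> ((\<lambda>y. f' y a) has_derivative f'' x) (at x)"
    and \<Omega>: "\<And>s t. 0 \<le> s \<Longrightarrow> s \<le> h \<Longrightarrow> 0 \<le> t \<Longrightarrow> t \<le> h \<Longrightarrow> q + s *\<^sub>R a + t *\<^sub>R b \<in> \<Omega>"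
    and h: "0 < h"
  obtains s t where "0 < s" "s < h" "0 < t" "t < h"
    "f (q + h *\<^sub>R a + h *\<^sub>R b) - f (q + h *\<^sub>R a) - f (q + h *\<^sub>R b) + f q
      = h * (h * f'' (q + s *\<^sub>R a + t *\<^sub>R b) b)"
proof -
  have line: "((\<lambda>s. g (p + s *\<^sub>R v)) has_real_derivative g' v) (at s)"
    if "(g has_derivative g') (at (p + s *\<^sub>R v))" for g :: "'a \<Rightarrow> real" and g' p v s
  proof -
    have "((\<lambda>s. g (p + s *\<^sub>R v)) has_derivative (\<lambda>r. g' (r *\<^sub>R v))) (at s)"
      by (rule has_derivative_compose[where f = "\<lambda>s. p + s *\<^sub>R v" and g = g])
         (use that in \<open>auto intro!: derivative_eq_intros\<close>)
    moreover have "g' (r *\<^sub>R v) = g' v * r" for r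
      using linear_scale[OF has_derivative_linear[OF that]] by simp
    ultimately show ?thesis by (simp add: has_field_derivative_def)
  qed
  let ?g = "\<lambda>s. f (q + h *\<^sub>R b + s *\<^sub>R a) - f (q + s *\<^sub>R a)"
  have "\<exists>s. 0 < s \<and> s < h \<and> ?g h - ?g 0 = (h - 0) * (f' (q + h *\<^sub>R b + s *\<^sub>R a) a - f' (q + s *\<^sub>R a) a)"
  proof (rule MVT2[OF h])
    fix s assume "0 \<le> s" "s \<le> h"
    with \<Omega>[of s h] \<Omega>[of s 0] h
    show "DERIV ?g s :> f' (q + h *\<^sub>R b + s *\<^sub>R a) a - f' (q + s *\<^sub>R a) a"
      by (intro DERIV_diff line f) (simp_all add: add.commute add.left_commute)
  qed
  then obtain s where s: "0 < s" "s < h"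
    "?g h - ?g 0 = h * (f' (q + h *\<^sub>R b + s *\<^sub>R a) a - f' (q + s *\<^sub>R a) a)" by auto
  let ?k = "\<lambda>t. f' (q + s *\<^sub>R a + t *\<^sub>R b) a"
  have "\<exists>t. 0 < t \<and> t < h \<and> ?k h - ?k 0 = (h - 0) * f'' (q + s *\<^sub>R a + t *\<^sub>R b) b"
  proof (rule MVT2[OF h])
    fix t assume "0 \<le> t" "t \<le> h"
    with \<Omega>[of s t] s show "DERIV ?k t :> f'' (q + s *\<^sub>R a + t *\<^sub>R b) b"
      by (intro line[of "\<lambda>y. f' y a"] fa) simp
  qed
  then obtain t where t: "0 < t" "t < h" "?k h - ?k 0 = h * f'' (q + s *\<^sub>R a + t *\<^sub>R b) b" by auto
  show thesis
    by (rule that[OF s(1,2) t(1,2)])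
       (use s(3) t(3) in \<open>simp add: algebra_simps\<close>)
qed

text \<open>
  The second difference of \<open>f\<close> is symmetric in \<open>a\<close> and \<open>b\<close>, so by the mean value theorem the two
  mixed derivatives take a common value, each at some point arbitrarily close to \<open>q\<close>; continuity
  gives equality at \<open>q\<close>.
\<close>

lemma second_derivatives_commute:
  fixes f :: "'a::real_normed_vector \<Rightarrow> real"
  assumes "open \<Omega>" "q \<in> \<Omega>"
    and f: "\<And>x. x \<in> \<Omega> \<Longrightarrow> (f has_derivative f' x) (at x)"
    and fa: "\<And>x. x \<in> \<Omega> \<Longrightarrow> ((\<lambda>y. f' y a) has_derivative fa' x) (at x)"
    and fb: "\<And>x. x \<in> \<Omega> \<Longrightarrow> ((\<lambda>y. f' y b) has_derivative fb' x) (at x)"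
    and cont: "continuous_on \<Omega> (\<lambda>x. fa' x b)" "continuous_on \<Omega> (\<lambda>x. fb' x a)"
  shows "fa' q b = fb' q a"
proof (rule ccontr)
  assume "fa' q b \<noteq> fb' q a"
  then have e: "\<bar>fa' q b - fb' q a\<bar> / 2 > 0" (is "?e > 0") by simp
  have "isCont (\<lambda>x. fa' x b) q" "isCont (\<lambda>x. fb' x a) q"
    using cont assms(1,2) by (simp_all add: continuous_on_eq_continuous_at)
  then obtain d1 d2 where d: "d1 > 0" "d2 > 0"
    and d1: "\<And>x. dist x q < d1 \<Longrightarrow> \<bar>fa' x b - fa' q b\<bar> < ?e"
    and d2: "\<And>x. dist x q < d2 \<Longrightarrow> \<bar>fb' x a - fb' q a\<bar> < ?e"
    unfolding continuous_at_eps_delta using e by (metis dist_real_def)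
  obtain r where r: "r > 0" "ball q r \<subseteq> \<Omega>" using assms(1,2) open_contains_ball by blast
  define d where "d = min r (min d1 d2)"
  \<comment> \<open>Small enough for the parallelogram spanned by \<open>h a\<close> and \<open>h b\<close> at \<open>q\<close> to have radius below \<open>d\<close>;
    the summand \<open>1\<close> covers \<open>a = b = 0\<close>.\<close>
  define h where "h = d / (norm a + norm b + 1)"
  have "d > 0" using r d by (simp add: d_def)
  have h: "h > 0" unfolding h_def using \<open>d > 0\<close>
    by (intro divide_pos_pos) (auto intro!: add_nonneg_pos add_nonneg_nonneg)
  have near: "dist (q + s *\<^sub>R v + t *\<^sub>R w) q < d"
    if "0 \<le> s" "s \<le> h" "0 \<le> t" "t \<le> h" "norm v + norm w = norm a + norm b" for s t v w
  proof -
    have "dist (q + s *\<^sub>R v + t *\<^sub>R w) q = norm (s *\<^sub>R v + t *\<^sub>R w)"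
      by (simp add: dist_norm add.assoc)
    also have "\<dots> \<le> s * norm v + t * norm w"
      using norm_triangle_ineq[of "s *\<^sub>R v" "t *\<^sub>R w"] that by simp
    also have "\<dots> \<le> h * norm v + h * norm w"
      using that by (intro add_mono mult_right_mono) auto
    also have "\<dots> = h * (norm a + norm b)"
      using that by (simp flip: distrib_left)
    also have "\<dots> < h * (norm a + norm b + 1)"
      using h by (intro mult_strict_left_mono) auto
    also have "\<dots> = d"
    proof -
      have "norm a + norm b + 1 \<noteq> 0" using norm_ge_zero[of a] norm_ge_zero[of b] by linarith
      then show ?thesis by (simp add: h_def)
    qed
    finally show ?thesis .
  qed
  have in\<Omega>: "q + s *\<^sub>R v + t *\<^sub>R w \<in> \<Omega>"
    if "0 \<le> s" "s \<le> h" "0 \<le> t" "t \<le> h" "norm v + norm w = norm a + norm b" for s t v w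
    using near[OF that] r(2) by (auto simp: d_def dist_commute subset_iff)
  obtain s t where st: "0 < s" "s < h" "0 < t" "t < h"
    "f (q + h *\<^sub>R a + h *\<^sub>R b) - f (q + h *\<^sub>R a) - f (q + h *\<^sub>R b) + f q
      = h * (h * fa' (q + s *\<^sub>R a + t *\<^sub>R b) b)"
    by (rule second_difference_mvt[OF f fa in\<Omega> h]) auto
  obtain s' t' where st': "0 < s'" "s' < h" "0 < t'" "t' < h"
    "f (q + h *\<^sub>R b + h *\<^sub>R a) - f (q + h *\<^sub>R b) - f (q + h *\<^sub>R a) + f q
      = h * (h * fb' (q + s' *\<^sub>R b + t' *\<^sub>R a) a)"
    by (rule second_difference_mvt[OF f fb in\<Omega> h]) (auto simp: add.commute)
  have "h * (h * fa' (q + s *\<^sub>R a + t *\<^sub>R b) b) = h * (h * fb' (q + s' *\<^sub>R b + t' *\<^sub>R a) a)"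
    using st(5) st'(5) by (simp add: algebra_simps)
  then have "fa' (q + s *\<^sub>R a + t *\<^sub>R b) b = fb' (q + s' *\<^sub>R b + t' *\<^sub>R a) a"
    using h by simp
  moreover have "\<bar>fa' (q + s *\<^sub>R a + t *\<^sub>R b) b - fa' q b\<bar> < ?e"
    using near[of s t a b] st by (intro d1) (simp add: d_def)
  moreover have "\<bar>fb' (q + s' *\<^sub>R b + t' *\<^sub>R a) a - fb' q a\<bar> < ?e"
    using near[of s' t' b a] st' by (intro d2) (simp add: d_def)
  ultimately show False
    using abs_triangle_ineq4[of "fa' (q + s *\<^sub>R a + t *\<^sub>R b) b - fb' q a"
      "fa' (q + s *\<^sub>R a + t *\<^sub>R b) b - fa' q b"] by simp
qed

text \<open>
  The mean value theorem is about real functions, so the real and the imaginary part are treated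
  separately.
\<close>

lemma dir_deriv_commute:
  assumes "open \<Omega>" "C_on 2 \<Omega> f" "a \<in> Basis" "b \<in> Basis" "q \<in> \<Omega>"
  shows "dir_deriv a (dir_deriv b f) q = dir_deriv b (dir_deriv a f) q"
proof -
  have P: "P (dir_deriv b (dir_deriv a f) q) = P (dir_deriv a (dir_deriv b f) q)"
    if "bounded_linear P" for P :: "complex \<Rightarrow> real"
  proof (rule second_derivatives_commute[OF assms(1,5),
        of "\<lambda>x. P (f x)" "\<lambda>x v. P (dir_deriv v f x)" a
           "\<lambda>x v. P (dir_deriv v (dir_deriv a f) x)" b "\<lambda>x v. P (dir_deriv v (dir_deriv b f) x)"])
    note der = bounded_linear.has_derivative[OF that has_derivative_dir_deriv]
    fix x assume "x \<in> \<Omega>"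
    with assms have "f differentiable (at x)" "dir_deriv a f differentiable (at x)"
      "dir_deriv b f differentiable (at x)"
      unfolding C_on_2 C_on_1 by blast+
    from this[THEN der]
    show "((\<lambda>x. P (f x)) has_derivative (\<lambda>v. P (dir_deriv v f x))) (at x)"
      "((\<lambda>y. P (dir_deriv a f y)) has_derivative (\<lambda>v. P (dir_deriv v (dir_deriv a f) x))) (at x)"
      "((\<lambda>y. P (dir_deriv b f y)) has_derivative (\<lambda>v. P (dir_deriv v (dir_deriv b f) x))) (at x)"
      by blast+
  next
    show "continuous_on \<Omega> (\<lambda>x. P (dir_deriv b (dir_deriv a f) x))"
      "continuous_on \<Omega> (\<lambda>x. P (dir_deriv a (dir_deriv b f) x))"
      using assms unfolding C_on_2 C_on_1
      by (blast intro: bounded_linear.continuous_on[OF that])+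
  qed
  show ?thesis
    using P[OF bounded_linear_Re] P[OF bounded_linear_Im] by (simp add: complex_eq_iff)
qed

section \<open>Compactly supported functions and integration\<close>

text \<open>
  A compact set \<open>K\<close> outside which \<open>\<phi>\<close> vanishes takes the place of the support: the same \<open>K\<close> then
  serves all derivatives of \<open>\<phi>\<close>.
\<close>

definition C_compact :: "nat \<Rightarrow> 'a::euclidean_space set \<Rightarrow> ('a \<Rightarrow> complex) \<Rightarrow> bool" where
  "C_compact k \<Omega> \<phi> \<longleftrightarrow> C_on k UNIV \<phi> \<and> (\<exists>K. compact K \<and> K \<subseteq> \<Omega> \<and> (\<forall>x. x \<notin> K \<longrightarrow> \<phi> x = 0))"

lemma dir_deriv_outside_compact:
  assumes "compact K" "\<And>x. x \<notin> K \<Longrightarrow> \<phi> x = 0" "q \<notin> K"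
  shows "dir_deriv b \<phi> q = 0"
proof -
  have "dir_deriv b \<phi> q = dir_deriv b (\<lambda>x. 0) q"
    by (rule dir_deriv_cong_open[where S = "- K"])
       (use assms in \<open>auto dest: compact_imp_closed\<close>)
  then show ?thesis by (simp add: dir_deriv_const)
qed

lemma C_compact_continuous: "C_compact 1 \<Omega> \<psi> \<Longrightarrow> continuous_on UNIV \<psi>"
  using C_on_1_continuous unfolding C_compact_def by blast

lemma compact_neighbourhood:
  fixes K :: "'a::euclidean_space set"
  assumes "compact K" "open \<Omega>" "K \<subseteq> \<Omega>"
  obtains \<delta> K' where "\<delta> > 0" "compact K'" "K' \<subseteq> \<Omega>" "\<And>x. x \<in> K \<Longrightarrow> cball x \<delta> \<subseteq> K'"
proof -
  obtain \<delta> where \<delta>: "\<delta> > 0" "(\<Union>x\<in>K. cball x \<delta>) \<subseteq> \<Omega>"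
    using compact_subset_open_imp_cball_epsilon_subset[OF assms] by blast
  have eq: "(\<Union>x\<in>K. cball x \<delta>) = {x + y | x y. x \<in> K \<and> y \<in> cball 0 \<delta>}"
  proof (intro equalityI subsetI)
    fix z assume "z \<in> (\<Union>x\<in>K. cball x \<delta>)"
    then obtain x where "x \<in> K" "z = x + (z - x)" "z - x \<in> cball 0 \<delta>"
      by (auto simp: dist_norm norm_minus_commute)
    then show "z \<in> {x + y | x y. x \<in> K \<and> y \<in> cball 0 \<delta>}" by blast
  next
    fix z assume "z \<in> {x + y | x y. x \<in> K \<and> y \<in> cball 0 \<delta>}"
    then obtain x y where "z = x + y" "x \<in> K" "norm y \<le> \<delta>" by auto
    then show "z \<in> (\<Union>x\<in>K. cball x \<delta>)" by (auto simp: dist_norm intro!: bexI[of _ x])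
  qed
  show thesis
  proof (rule that[OF \<delta>(1) _ \<delta>(2)])
    show "compact (\<Union>x\<in>K. cball x \<delta>)"
      unfolding eq by (intro compact_sums assms compact_cball)
  qed blast
qed

lemma indicator_support:
  assumes "K \<subseteq> \<Omega>" "\<And>x. x \<notin> K \<Longrightarrow> g x = 0"
  shows "indicator \<Omega> x *\<^sub>R (g x :: complex) = indicator K x *\<^sub>R g x"
  using assms by (auto simp: indicator_def)

lemma set_integrable_compact_support:
  fixes g :: "'a::euclidean_space \<Rightarrow> complex"
  assumes "compact K" "K \<subseteq> \<Omega>" "\<And>x. x \<notin> K \<Longrightarrow> g x = 0" "continuous_on \<Omega> w" "continuous_on \<Omega> g"
  shows "set_integrable lborel \<Omega> (\<lambda>x. w x * g x)"
proof -
  have "integrable lborel (\<lambda>x. indicator K x *\<^sub>R (w x * g x))"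
    using assms by (intro borel_integrable_compact continuous_intros) (auto intro: continuous_on_subset)
  then show ?thesis
    unfolding set_integrable_def using assms by (subst indicator_support[of K]) auto
qed

lemma C_compact_set_integrable:
  assumes "C_compact 1 \<Omega> \<phi>" "continuous_on \<Omega> w" "b \<in> Basis"
  shows "set_integrable lborel \<Omega> (\<lambda>x. w x * dir_deriv b \<phi> x)"
proof -
  obtain K where K: "compact K" "K \<subseteq> \<Omega>" "\<And>x. x \<notin> K \<Longrightarrow> \<phi> x = 0"
    using assms unfolding C_compact_def by blast
  have "continuous_on UNIV (dir_deriv b \<phi>)"
    using assms unfolding C_compact_def C_on_1 by blast
  then show ?thesis
    using K assms(2) by (intro set_integrable_compact_support[of K])
      (auto intro: continuous_on_subset dir_deriv_outside_compact)
qed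

lemma set_integral_sum:
  fixes f :: "'i \<Rightarrow> 'a \<Rightarrow> complex"
  assumes "\<And>i. i \<in> S \<Longrightarrow> set_integrable M A (f i)"
  shows "set_integrable M A (\<lambda>x. \<Sum>i\<in>S. f i x)"
    and "(LINT x:A|M. \<Sum>i\<in>S. f i x) = (\<Sum>i\<in>S. LINT x:A|M. f i x)"
  using assms unfolding set_integrable_def set_lebesgue_integral_def
  by (simp_all add: scaleR_sum_right)

lemma integral_translate:
  fixes f :: "'a::euclidean_space \<Rightarrow> complex"
  assumes "continuous_on UNIV f"
  shows "(LINT x|lborel. f (x + v)) = (LINT x|lborel. f x)"
    and "integrable lborel f \<Longrightarrow> integrable lborel (\<lambda>x. f (x + v))"
proof -
  have meas: "f \<in> borel_measurable borel"
    using assms by (rule borel_measurable_continuous_onI)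
  then have "(LINT x|distr lborel borel ((+) v). f x) = (LINT x|lborel. f (v + x))"
    by (intro integral_distr) auto
  then show "(LINT x|lborel. f (x + v)) = (LINT x|lborel. f x)"
    by (simp add: lborel_distr_plus add.commute)
  have "integrable (distr lborel borel ((+) v)) f \<longleftrightarrow> integrable lborel (\<lambda>x. f (v + x))"
    using meas by (intro integrable_distr_eq) auto
  then show "integrable lborel f \<Longrightarrow> integrable lborel (\<lambda>x. f (x + v))"
    by (simp add: lborel_distr_plus add.commute)
qed

section \<open>Averages over segments\<close>

definition line_average ::
    "real \<Rightarrow> 'a::euclidean_space \<Rightarrow> ('a \<Rightarrow> complex) \<Rightarrow> 'a \<Rightarrow> complex" where
  "line_average h b g x = integral (cbox 0 1) (\<lambda>t. g (x + (h * t) *\<^sub>R b))"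

lemma has_derivative_translate:
  assumes "(f has_derivative f') (at (x + v))"
  shows "((\<lambda>x. f (x + v)) has_derivative f') (at x)"
  by (rule has_derivative_compose[where f = "\<lambda>x. x + v" and f' = "\<lambda>h. h" and g = f and g' = f'])
     (use assms in \<open>auto intro!: derivative_eq_intros\<close>)

lemma line_average_continuous:
  assumes "continuous_on UNIV g"
  shows "continuous_on UNIV (line_average h b g)"
    and "continuous_on UNIV (\<lambda>h. line_average h b g x)"
proof -
  show "continuous_on UNIV (line_average h b g)"
    unfolding line_average_def[abs_def]
    by (rule integral_continuous_on_param, unfold split_beta, rule continuous_on_compose2[OF assms])
       (auto intro!: continuous_intros)
  show "continuous_on UNIV (\<lambda>h. line_average h b g x)"
    unfolding line_average_def
    by (rule integral_continuous_on_param, unfold split_beta, rule continuous_on_compose2[OF assms])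
       (auto intro!: continuous_intros)
qed

lemma line_integrable:
  fixes g :: "'a::euclidean_space \<Rightarrow> 'b::banach"
  assumes "continuous_on UNIV g"
  shows "(\<lambda>t. g (x + (h * t) *\<^sub>R b)) integrable_on cbox 0 (1::real)"
  by (rule integrable_continuous, rule continuous_on_compose2[OF assms])
     (auto intro!: continuous_intros)

lemma line_average_tendsto:
  assumes "continuous_on UNIV g" "h \<longlonglongrightarrow> 0"
  shows "(\<lambda>m. line_average (h m) b g x) \<longlonglongrightarrow> g x"
proof -
  have "isCont (\<lambda>h. line_average h b g x) 0"
    using line_average_continuous(2)[OF assms(1)] by (simp add: continuous_on_eq_continuous_at)
  from isCont_tendsto_compose[OF this assms(2)] show ?thesis
    by (simp add: line_average_def)
qed

lemma line_average_bound:
  assumes "continuous_on UNIV g" "\<And>x. norm (g x) \<le> M"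
  shows "norm (line_average h b g x) \<le> M"
proof -
  have "norm (line_average h b g x) \<le> M * (1 - 0)"
    unfolding line_average_def box_real
  proof (rule integral_bound)
    show "continuous_on {0..1} (\<lambda>t. g (x + (h * t) *\<^sub>R b))"
      by (rule continuous_on_compose2[OF assms(1)]) (auto intro!: continuous_intros)
  qed (use assms in auto)
  then show ?thesis by simp
qed

lemma line_average_support:
  assumes "\<And>x. x \<notin> K \<Longrightarrow> g x = 0" "\<And>x. x \<in> K \<Longrightarrow> cball x \<delta> \<subseteq> K'"
    and "norm b = 1" "0 \<le> h" "h \<le> \<delta>" "x \<notin> K'"
  shows "line_average h b g x = 0"
proof -
  have "g (x + (h * t) *\<^sub>R b) = 0" if "t \<in> cbox 0 1" for t
  proof -
    have "h * t \<le> h * 1" using that assms by (intro mult_left_mono) auto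
    then have "x \<in> cball (x + (h * t) *\<^sub>R b) \<delta>"
      using that assms by (simp add: dist_norm abs_mult)
    with assms(1,2,6) show ?thesis by blast
  qed
  then have "line_average h b g x = integral (cbox 0 1) (\<lambda>t::real. 0)"
    unfolding line_average_def by (rule integral_cong)
  then show ?thesis by simp
qed

text \<open>
  Averaging commutes with differentiation, by differentiation under the integral sign.  By the
  fundamental theorem of calculus the average of the derivative in the direction \<open>b\<close> of the
  segments is a difference quotient of \<open>f\<close>; this is how averaging gains a derivative.
\<close>

lemma line_average_dir_deriv:
  assumes "C_on 1 UNIV f"
  shows "C_on 1 UNIV (line_average h b f)"
    and "dir_deriv c (line_average h b f) = line_average h b (dir_deriv c f)"
    and "of_real h * line_average h b (dir_deriv b f) x = f (x + h *\<^sub>R b) - f x"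
proof -
  obtain Df :: "'a \<Rightarrow> 'a \<Rightarrow>\<^sub>L complex"
    where Df: "\<And>x. (f has_derivative Df x) (at x)" and cont: "continuous_on UNIV Df"
    by (rule C_on_1_derivative[OF assms], rule that) (assumption | simp)+
  have D: "dir_deriv c f x = Df x c" for c x
    by (rule dir_deriv_eq[OF Df])
  define I where "I x = integral (cbox 0 1) (\<lambda>t. Df (x + (h * t) *\<^sub>R b))" for x
  have shift: "((\<lambda>x. f (x + v)) has_derivative Df (x + v)) (at x)" for x v
    by (rule has_derivative_translate[OF Df])
  have der: "(line_average h b f has_derivative I x) (at x)" for x
    unfolding line_average_def[abs_def] I_def
  proof (rule leibniz_rule[where U = UNIV and fx = "\<lambda>x t. Df (x + (h * t) *\<^sub>R b)"])
    show "(\<lambda>t. f (x + (h * t) *\<^sub>R b)) integrable_on cbox 0 1" for x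
      by (rule line_integrable) (use C_on_1_continuous[OF assms] in simp)
    show "continuous_on (UNIV \<times> cbox 0 1) (\<lambda>(x, t). Df (x + (h * t) *\<^sub>R b))"
      unfolding split_beta
      by (rule continuous_on_compose2[OF cont]) (auto intro!: continuous_intros)
  qed (use shift in auto)
  have "continuous_on UNIV I"
    unfolding I_def[abs_def]
    by (rule integral_continuous_on_param, unfold split_beta, rule continuous_on_compose2[OF cont])
       (auto intro!: continuous_intros)
  with der show "C_on 1 UNIV (line_average h b f)" by (rule C_on_1I)
  show "dir_deriv c (line_average h b f) = line_average h b (dir_deriv c f)"
  proof
    fix x
    show "dir_deriv c (line_average h b f) x = line_average h b (dir_deriv c f) x"
      using blinfun_apply_integral[OF line_integrable[OF cont]]
      by (simp add: dir_deriv_eq[OF der] I_def line_average_def D)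
  qed
  have "((\<lambda>t. of_real h * Df (x + (h * t) *\<^sub>R b) b) has_integral
      f (x + (h * 1) *\<^sub>R b) - f (x + (h * 0) *\<^sub>R b)) {0..1}"
  proof (rule fundamental_theorem_of_calculus)
    fix t :: real
    have "((\<lambda>t. f (x + (h * t) *\<^sub>R b)) has_derivative
        (\<lambda>s. Df (x + (h * t) *\<^sub>R b) ((h * s) *\<^sub>R b))) (at t within {0..1})"
      by (rule has_derivative_compose[where f = "\<lambda>t. x + (h * t) *\<^sub>R b" and g = f, OF _ Df])
         (auto intro!: derivative_eq_intros)
    then show "((\<lambda>t. f (x + (h * t) *\<^sub>R b)) has_vector_derivative
        of_real h * Df (x + (h * t) *\<^sub>R b) b) (at t within {0..1})"
      by (simp add: has_vector_derivative_def blinfun.scaleR_right scaleR_conv_of_real mult_ac)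
  qed simp
  from integral_unique[OF this]
  have "of_real h * integral {0..1} (\<lambda>t. Df (x + (h * t) *\<^sub>R b) b) = f (x + h *\<^sub>R b) - f x"
    by simp
  then show "of_real h * line_average h b (dir_deriv b f) x = f (x + h *\<^sub>R b) - f x"
    unfolding line_average_def D box_real .
qed

text \<open>
  Dominated convergence: the averages are bounded by a bound for \<open>g\<close> and vanish outside the
  compact neighbourhood \<open>K'\<close> of \<open>K\<close>, on which \<open>w\<close> is bounded.
\<close>

lemma tendsto_integral_line_average:
  fixes g :: "'a::euclidean_space \<Rightarrow> complex"
  assumes "open \<Omega>" "continuous_on \<Omega> w" "continuous_on UNIV g"
    and K: "compact K" "\<And>x. x \<notin> K \<Longrightarrow> g x = 0"
    and K': "compact K'" "K' \<subseteq> \<Omega>" "\<And>x. x \<in> K \<Longrightarrow> cball x \<delta> \<subseteq> K'"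
    and b: "norm b = 1" and h: "\<And>m. 0 \<le> h m" "\<And>m. h m \<le> \<delta>" "h \<longlonglongrightarrow> 0"
  shows "(\<lambda>m. LINT x:\<Omega>|lborel. w x * line_average (h m) b g x) \<longlonglongrightarrow> (LINT x:\<Omega>|lborel. w x * g x)"
proof -
  have "compact (g ` K)" "compact (w ` K')"
    using assms by (auto intro!: compact_continuous_image intro: continuous_on_subset)
  then have "bounded (g ` K)" "bounded (w ` K')"
    by (simp_all add: compact_imp_bounded)
  then obtain M N where "\<And>x. x \<in> K \<Longrightarrow> norm (g x) \<le> M" and N: "\<And>x. x \<in> K' \<Longrightarrow> norm (w x) \<le> N"
    unfolding bounded_iff by auto
  then have M: "norm (g x) \<le> max M 0" for x
    using K(2)[of x] by (cases "x \<in> K") (auto simp: le_max_iff_disj)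
  have meas: "(\<lambda>x. indicator \<Omega> x *\<^sub>R (w x * f x)) \<in> borel_measurable lborel"
    if "continuous_on UNIV f" for f
    using borel_measurable_continuous_on_indicator[of \<Omega> "\<lambda>x. w x * f x"] assms(1,2) that
    by (auto intro!: continuous_intros intro: continuous_on_subset)
  show ?thesis
    unfolding set_lebesgue_integral_def
  proof (rule integral_dominated_convergence)
    show "(\<lambda>x. indicator \<Omega> x *\<^sub>R (w x * g x)) \<in> borel_measurable lborel"
      "(\<lambda>x. indicator \<Omega> x *\<^sub>R (w x * line_average (h m) b g x)) \<in> borel_measurable lborel" for m
      using assms(3) by (intro meas line_average_continuous(1); assumption)+
    show "integrable lborel (\<lambda>x. indicator K' x *\<^sub>R (N * max M 0))"
      using K' by (intro borel_integrable_compact) auto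
    show "AE x in lborel. (\<lambda>m. indicator \<Omega> x *\<^sub>R (w x * line_average (h m) b g x))
        \<longlonglongrightarrow> indicator \<Omega> x *\<^sub>R (w x * g x)"
      by (intro AE_I2 tendsto_intros line_average_tendsto assms)
    show "AE x in lborel. norm (indicator \<Omega> x *\<^sub>R (w x * line_average (h m) b g x))
        \<le> indicator K' x *\<^sub>R (N * max M 0)" for m
    proof (rule AE_I2)
      fix x
      show "norm (indicator \<Omega> x *\<^sub>R (w x * line_average (h m) b g x)) \<le> indicator K' x *\<^sub>R (N * max M 0)"
      proof (cases "x \<in> K'")
        case True
        have "norm (w x * line_average (h m) b g x) \<le> N * max M 0"
          unfolding norm_mult
          using N[OF True] line_average_bound[OF assms(3) M]
          by (intro mult_mono) (auto intro: order_trans[OF norm_ge_zero])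
        with True K' show ?thesis by auto
      next
        case False
        have "line_average (h m) b g x = 0"
          by (rule line_average_support[of K g \<delta> K']) (use False K K' b h in auto)
        then show ?thesis using False by simp
      qed
    qed
  qed
qed

lemma line_average_steps:
  fixes \<delta> :: real
  assumes "\<delta> > 0"
  shows "0 < \<delta> / real (Suc m)" "\<delta> / real (Suc m) \<le> \<delta>" "(\<lambda>m. \<delta> / real (Suc m)) \<longlonglongrightarrow> 0"
proof -
  show "0 < \<delta> / real (Suc m)" using assms by simp
  have "\<delta> * 1 \<le> \<delta> * real (Suc m)" using assms by (intro mult_left_mono) auto
  then show "\<delta> / real (Suc m) \<le> \<delta>" by (simp add: divide_le_eq)
  show "(\<lambda>m. \<delta> / real (Suc m)) \<longlonglongrightarrow> 0"
    using tendsto_mult[OF tendsto_const[of \<delta>] LIMSEQ_inverse_real_of_nat]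
    by (simp add: divide_inverse)
qed

text \<open>
  The averages of \<open>dir_deriv b \<psi>\<close> over segments in direction \<open>b\<close> are difference quotients of
  \<open>\<psi>\<close>.  These have integral \<open>0\<close> by translation invariance, and they converge to
  \<open>dir_deriv b \<psi>\<close>.
\<close>

lemma integral_dir_deriv_eq_0:
  assumes "C_compact 1 \<Omega> \<psi>" "b \<in> Basis"
  shows "(LINT x:\<Omega>|lborel. dir_deriv b \<psi> x) = 0"
proof -
  obtain K where K: "compact K" "K \<subseteq> \<Omega>" "\<And>x. x \<notin> K \<Longrightarrow> \<psi> x = 0"
    using assms unfolding C_compact_def by blast
  have C1: "C_on 1 UNIV \<psi>" using assms unfolding C_compact_def by blast
  have outside: "dir_deriv b \<psi> x = 0" if "x \<notin> K" for b x
    by (rule dir_deriv_outside_compact[OF K(1) _ that]) (rule K(3))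
  have cont: "continuous_on UNIV (dir_deriv b \<psi>)"
    using C1 assms(2) unfolding C_on_1 by blast
  obtain \<delta> K' where \<delta>: "\<delta> > 0" "compact K'" "K' \<subseteq> UNIV" "\<And>x. x \<in> K \<Longrightarrow> cball x \<delta> \<subseteq> K'"
    using compact_neighbourhood[OF K(1), of UNIV] by auto
  define h where "h m = \<delta> / real (Suc m)" for m
  note h = line_average_steps[OF \<delta>(1), folded h_def]
  have int: "integrable lborel \<psi>"
    using set_integrable_compact_support[OF K(1) subset_UNIV K(3), where w = "\<lambda>x. 1"]
      C_compact_continuous[OF assms(1)] by (simp add: set_integrable_def)
  have zero: "(LINT x:UNIV|lborel. 1 * line_average (h m) b (dir_deriv b \<psi>) x) = 0" for m
  proof -
    have "of_real (h m) * (LINT x:UNIV|lborel. 1 * line_average (h m) b (dir_deriv b \<psi>) x)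
        = (LINT x|lborel. \<psi> (x + h m *\<^sub>R b) - \<psi> x)"
      unfolding set_lebesgue_integral_def
      by (simp add: line_average_dir_deriv(3)[OF C1, symmetric])
    also have "\<dots> = 0"
      using integral_translate[OF C_compact_continuous[OF assms(1)]] int by simp
    finally show ?thesis using h(1)[of m] by simp
  qed
  have "(\<lambda>m. LINT x:UNIV|lborel. 1 * line_average (h m) b (dir_deriv b \<psi>) x)
      \<longlonglongrightarrow> (LINT x:UNIV|lborel. 1 * dir_deriv b \<psi> x)"
    by (rule tendsto_integral_line_average[OF _ _ cont K(1) _ \<delta>(2-4)])
       (use assms(2) less_imp_le[OF h(1)] h(2,3) outside in auto)
  then have "(LINT x:UNIV|lborel. dir_deriv b \<psi> x) = 0"
    unfolding zero using LIMSEQ_unique[OF tendsto_const] by fastforce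
  moreover have "indicator \<Omega> x *\<^sub>R dir_deriv b \<psi> x = indicator UNIV x *\<^sub>R dir_deriv b \<psi> x" for x
    using outside[of x] K(2) by (auto simp: indicator_def)
  ultimately show ?thesis
    by (simp add: set_lebesgue_integral_def)
qed

text \<open>
  The functional \<open>\<phi> \<mapsto> \<Sum>\<^sub>i \<integral> w\<^sub>i \<partial>\<^sub>c\<^sub>i \<phi>\<close> involves first derivatives only, so it is continuous under
  averaging.  The condition that \<open>dir_deriv b \<phi>\<close> be \<open>C^1\<close> is imposed for all basis vectors \<open>b\<close> in the
  assumption and can be dropped for one \<open>b\<close> after the other, since averaging in direction \<open>b\<close>
  enforces it and preserves it for the other basis vectors.
\<close>

lemma vanishes_on_C1_if_on_C2:
  fixes w :: "'i \<Rightarrow> 'a::euclidean_space \<Rightarrow> complex" and c :: "'i \<Rightarrow> 'a"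
  assumes "open \<Omega>" and w: "\<And>i. i \<in> S \<Longrightarrow> continuous_on \<Omega> (w i)" and c: "\<And>i. i \<in> S \<Longrightarrow> c i \<in> Basis"
    and C2: "\<And>\<phi>. C_compact 2 \<Omega> \<phi> \<Longrightarrow> (\<Sum>i\<in>S. LINT x:\<Omega>|lborel. w i x * dir_deriv (c i) \<phi> x) = 0"
    and "C_compact 1 \<Omega> \<phi>"
  shows "(\<Sum>i\<in>S. LINT x:\<Omega>|lborel. w i x * dir_deriv (c i) \<phi> x) = 0"
proof -
  define L where "L \<phi> = (\<Sum>i\<in>S. LINT x:\<Omega>|lborel. w i x * dir_deriv (c i) \<phi> x)" for \<phi>
  \<comment> \<open>Dropping the condition for the single basis vector \<open>b\<close>.\<close>
  have step: "L \<phi> = 0"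
    if B: "b \<in> Basis" "B \<subseteq> Basis"
      and L: "\<And>\<phi>. C_compact 1 \<Omega> \<phi> \<Longrightarrow> \<forall>a\<in>insert b B. C_on 1 UNIV (dir_deriv a \<phi>) \<Longrightarrow> L \<phi> = 0"
      and \<phi>: "C_compact 1 \<Omega> \<phi>" "\<forall>a\<in>B. C_on 1 UNIV (dir_deriv a \<phi>)" for b B \<phi>
  proof -
    obtain K where K: "compact K" "K \<subseteq> \<Omega>" "\<And>x. x \<notin> K \<Longrightarrow> \<phi> x = 0"
      using \<phi> unfolding C_compact_def by blast
    have outside: "dir_deriv a \<phi> x = 0" if "x \<notin> K" for a x
      by (rule dir_deriv_outside_compact[OF K(1) _ that]) (rule K(3))
    have C1: "C_on 1 UNIV \<phi>" using \<phi> unfolding C_compact_def by blast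
    obtain \<delta> K' where \<delta>: "\<delta> > 0" "compact K'" "K' \<subseteq> \<Omega>" "\<And>x. x \<in> K \<Longrightarrow> cball x \<delta> \<subseteq> K'"
      using compact_neighbourhood[OF K(1) assms(1) K(2)] by blast
    define h where "h m = \<delta> / real (Suc m)" for m
    note h = line_average_steps[OF \<delta>(1), folded h_def]
    have "L (line_average (h m) b \<phi>) = 0" for m
    proof (rule L)
      have "line_average (h m) b \<phi> x = 0" if "x \<notin> K'" for x
        by (rule line_average_support[of K \<phi> \<delta> K']) (use K \<delta> h B that in \<open>auto simp: less_imp_le\<close>)
      with \<delta> show "C_compact 1 \<Omega> (line_average (h m) b \<phi>)"
        unfolding C_compact_def using line_average_dir_deriv(1)[OF C1] by blast
      have "C_on 1 UNIV (dir_deriv b (line_average (h m) b \<phi>))"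
      proof -
        have "line_average (h m) b (dir_deriv b \<phi>)
            = (\<lambda>x. inverse (of_real (h m)) * (\<phi> (x + h m *\<^sub>R b) + (- 1) * \<phi> x))"
          using line_average_dir_deriv(3)[OF C1, of "h m" b] h(1)[of m]
          by (simp add: fun_eq_iff field_simps)
        moreover have "C_on 1 UNIV (\<lambda>x. \<phi> (x + v))" for v
        proof -
          obtain Df :: "'a \<Rightarrow> 'a \<Rightarrow>\<^sub>L complex"
            where Df: "\<And>x. (\<phi> has_derivative Df x) (at x)" and contD: "continuous_on UNIV Df"
            by (rule C_on_1_derivative[OF C1], rule that) (assumption | simp)+
          show ?thesis
          proof (rule C_on_1I)
            show "((\<lambda>x. \<phi> (x + v)) has_derivative Df (x + v)) (at x)" for x
              by (rule has_derivative_translate[OF Df])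
            show "continuous_on UNIV (\<lambda>x. Df (x + v))"
              by (rule continuous_on_compose2[OF contD]) (auto intro!: continuous_intros)
          qed
        qed
        ultimately show ?thesis
          unfolding line_average_dir_deriv(2)[OF C1]
          using C1 by (simp only:) (intro C_on_1_mult C_on_1_add C_on_1_const)
      qed
      then show "\<forall>a\<in>insert b B. C_on 1 UNIV (dir_deriv a (line_average (h m) b \<phi>))"
        using \<phi>(2) line_average_dir_deriv(1) unfolding line_average_dir_deriv(2)[OF C1] by blast
    qed
    moreover have "(\<lambda>m. L (line_average (h m) b \<phi>)) \<longlonglongrightarrow> L \<phi>"
      unfolding L_def line_average_dir_deriv(2)[OF C1]
    proof (rule tendsto_sum)
      fix i assume i: "i \<in> S"
      have "continuous_on UNIV (dir_deriv (c i) \<phi>)"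
        using C1 c[OF i] unfolding C_on_1 by blast
      then show "(\<lambda>m. LINT x:\<Omega>|lborel. w i x * line_average (h m) b (dir_deriv (c i) \<phi>) x)
          \<longlonglongrightarrow> (LINT x:\<Omega>|lborel. w i x * dir_deriv (c i) \<phi> x)"
        by (rule tendsto_integral_line_average[OF assms(1) w[OF i] _ K(1) _ \<delta>(2-4)])
           (use B less_imp_le[OF h(1)] h(2,3) outside in auto)
    qed
    ultimately show "L \<phi> = 0"
      using LIMSEQ_unique[OF tendsto_const] by fastforce
  qed
  have "L \<phi> = 0" if "finite B" "B \<subseteq> Basis"
    "\<And>\<phi>. C_compact 1 \<Omega> \<phi> \<Longrightarrow> \<forall>a\<in>B. C_on 1 UNIV (dir_deriv a \<phi>) \<Longrightarrow> L \<phi> = 0" for B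
    using that
  proof (induction B rule: finite_induct)
    case empty
    then show ?case using assms by blast
  next
    case (insert b B)
    then show ?case using step[of b B] by blast
  qed
  from this[of Basis] have "L \<phi> = 0"
    using C2 unfolding L_def[symmetric] C_compact_def C_on_2 C_on_1 by auto
  then show ?thesis by (simp add: L_def)
qed

section \<open>The operators on functions\<close>

text \<open>
  Each \<open>\<nabla>\<^sub>j\<^sub>\<alpha>\<close> is a combination of the derivatives in two consecutive coordinates, the first of which
  has this index.
\<close>

definition nabla_index :: "nat \<Rightarrow> nat \<Rightarrow> nat" where
  "nabla_index j \<alpha> = 4 * (j div 2) + (if even j \<longleftrightarrow> \<alpha> = 0 then 0 else 2)"

definition nabla_coeff :: "nat \<Rightarrow> nat \<Rightarrow> nat \<Rightarrow> complex" where
  "nabla_coeff j \<alpha> s = (if even j \<and> \<alpha> \<noteq> 0 then -1 else 1) *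
     (if s = 0 then 1 else if even j then \<i> else - \<i>)"

lemma nabla_eq:
  "nabla D j \<alpha> f x = nabla_coeff j \<alpha> 0 * D (nabla_index j \<alpha>) f x
     + nabla_coeff j \<alpha> 1 * D (nabla_index j \<alpha> + 1) f x"
  by (auto simp: nabla_def nabla_index_def nabla_coeff_def Let_def numeral_3_eq_3)

abbreviation nabla_classical ::
    "(nat \<Rightarrow> 'n::finite) \<Rightarrow> nat \<Rightarrow> nat \<Rightarrow> ('n qspace \<Rightarrow> complex) \<Rightarrow> 'n qspace \<Rightarrow> complex" where
  "nabla_classical e \<equiv> nabla (\<lambda>i. dir_deriv (coord_vec e i))"

lemma coord_vec_Basis: "coord_vec e i \<in> Basis"
  by (simp add: coord_vec_def axis_in_Basis_iff)

lemma nabla_classical_const: "nabla_classical e j \<alpha> (\<lambda>x. c) q = 0"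
  by (simp add: nabla_eq dir_deriv_const)

lemma nabla_classical_outside_compact:
  "compact K \<Longrightarrow> (\<And>x. x \<notin> K \<Longrightarrow> \<phi> x = 0) \<Longrightarrow> q \<notin> K \<Longrightarrow> nabla_classical e j \<alpha> \<phi> q = 0"
  by (simp add: nabla_eq dir_deriv_outside_compact)

lemma nabla_classical_continuous:
  assumes "C_on 1 \<Omega> f"
  shows "continuous_on \<Omega> (nabla_classical e j \<alpha> f)"
proof -
  have "continuous_on \<Omega> (dir_deriv (coord_vec e i) f)" for i
    using assms coord_vec_Basis unfolding C_on_1 by blast
  then show ?thesis
    unfolding nabla_eq[abs_def] by (intro continuous_intros)
qed

lemma nabla_classical_C1:
  assumes "C_on 2 \<Omega> f"
  shows "C_on 1 \<Omega> (nabla_classical e j \<alpha> f)"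
proof -
  have "C_on 1 \<Omega> (dir_deriv (coord_vec e i) f)" for i
    using assms coord_vec_Basis unfolding C_on_2 by blast
  then show ?thesis
    unfolding nabla_eq[abs_def] by (intro C_on_1_add C_on_1_mult C_on_1_const)
qed

lemma nabla_classical_mult:
  "f differentiable (at q) \<Longrightarrow> g differentiable (at q) \<Longrightarrow>
    nabla_classical e j \<alpha> (\<lambda>x. f x * g x) q
      = f q * nabla_classical e j \<alpha> g q + nabla_classical e j \<alpha> f q * g q"
  by (simp add: nabla_eq dir_deriv_mult algebra_simps)

lemma nabla_classical_commute:
  assumes "open \<Omega>" "C_on 2 \<Omega> f" "q \<in> \<Omega>"
  shows "nabla_classical e j \<alpha> (nabla_classical e k \<beta> f) q
       = nabla_classical e k \<beta> (nabla_classical e j \<alpha> f) q"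
proof -
  let ?D = "\<lambda>i. dir_deriv (coord_vec e i)"
  have "?D i f differentiable (at q)" for i
    using assms(2,3) coord_vec_Basis unfolding C_on_2 C_on_1 by blast
  then have lin: "?D i (\<lambda>x. a * ?D l f x + b * ?D m f x) q = a * ?D i (?D l f) q + b * ?D i (?D m f) q"
    for i l m a b
    by (simp add: dir_deriv_add dir_deriv_cmult)
  have comm: "?D i (?D l f) q = ?D l (?D i f) q" for i l
    by (intro dir_deriv_commute[OF assms(1,2)] coord_vec_Basis assms(3))
  show ?thesis
    unfolding nabla_eq[of _ k \<beta> f, abs_def] nabla_eq[of _ j \<alpha> f, abs_def]
    unfolding nabla_eq lin
    by (simp add: algebra_simps comm[of "nabla_index j \<alpha>"] comm[of "Suc (nabla_index j \<alpha>)"])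
qed

lemma set_integrable_nabla_mult:
  assumes "C_compact 1 \<Omega> \<phi>" "continuous_on \<Omega> w"
  shows "set_integrable lborel \<Omega> (\<lambda>q. w q * nabla_classical e k \<alpha> \<phi> q)"
proof -
  obtain K where K: "compact K" "K \<subseteq> \<Omega>" "\<And>x. x \<notin> K \<Longrightarrow> \<phi> x = 0"
    using assms unfolding C_compact_def by blast
  have "continuous_on UNIV (nabla_classical e k \<alpha> \<phi>)"
    using assms nabla_classical_continuous unfolding C_compact_def by blast
  then show ?thesis
    using assms(2) K by (intro set_integrable_compact_support[of K])
      (auto intro: continuous_on_subset nabla_classical_outside_compact)
qed

lemma d_zero_form:
  fixes e :: "nat \<Rightarrow> 'n::finite"
  shows "d_classical e \<alpha> (zero_form u) q
    = (\<lambda>J. \<Sum>k<2 * CARD('n). nabla_classical e k \<alpha> u q * omega {k} J)"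
proof
  fix J
  have "(\<Sum>I\<in>Pow {..<2 * CARD('n)}. nabla_classical e k \<alpha> (\<lambda>y. u y * omega {} I) q * (omega {k} \<and>\<^sub>e omega I) J)
      = nabla_classical e k \<alpha> u q * omega {k} J" for k
  proof -
    have "(\<Sum>I\<in>Pow {..<2 * CARD('n)}. nabla_classical e k \<alpha> (\<lambda>y. u y * omega {} I) q * (omega {k} \<and>\<^sub>e omega I) J)
        = (\<Sum>I\<in>Pow {..<2 * CARD('n)}. if I = {} then nabla_classical e k \<alpha> u q * omega {k} J else 0)"
      by (intro sum.cong refl)
         (auto simp: omega_apply[of "{}"] nabla_classical_const wedge_omega_empty)
    then show ?thesis by simp
  qed
  then show "d_classical e \<alpha> (zero_form u) q J
      = (\<Sum>k<2 * CARD('n). nabla_classical e k \<alpha> u q * omega {k} J)"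
    by (simp add: d_classical_def d_gen_def zero_form_def)
qed

lemma d_zero_form_wedge:
  fixes e :: "nat \<Rightarrow> 'n::finite"
  shows "(d_classical e \<alpha> (zero_form u) q \<and>\<^sub>e a) J
    = (\<Sum>k<2 * CARD('n). nabla_classical e k \<alpha> u q * (omega {k} \<and>\<^sub>e a) J)"
  unfolding d_zero_form wedge_sum_left ..

text \<open>
  The coefficient of \<open>d\<^sub>\<gamma> u\<close> at a singleton \<open>{k}\<close> is exactly the function \<open>\<nabla>\<^sub>k\<^sub>\<gamma> u\<close>, and its other
  coefficients are identically \<open>0\<close>.  Hence \<open>\<nabla>\<^sub>j\<^sub>\<beta>\<close> is only ever applied to a single \<open>\<nabla>\<^sub>k\<^sub>\<gamma> u\<close> or to \<open>0\<close>,
  never to a sum.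
\<close>

lemma d_d_zero_form:
  fixes e :: "nat \<Rightarrow> 'n::finite"
  shows "d_classical e \<beta> (d_classical e \<gamma> (zero_form u)) q
    = (\<lambda>J. \<Sum>j<2 * CARD('n). \<Sum>k<2 * CARD('n).
        nabla_classical e j \<beta> (nabla_classical e k \<gamma> u) q * (omega {j} \<and>\<^sub>e omega {k}) J)"
proof
  fix J
  let ?N = "{..<2 * CARD('n)}"
  have outer: "d_classical e \<beta> G q J = (\<Sum>j\<in>?N. \<Sum>I\<in>Pow ?N.
      nabla_classical e j \<beta> (\<lambda>y. G y I) q * (omega {j} \<and>\<^sub>e omega I) J)" for G
    by (simp add: d_classical_def d_gen_def)
  let ?du = "\<lambda>I y. \<Sum>k\<in>?N. nabla_classical e k \<gamma> u y * omega {k} I"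
  have "(\<Sum>I\<in>Pow ?N. nabla_classical e j \<beta> (?du I) q * (omega {j} \<and>\<^sub>e omega I) J)
      = (\<Sum>k\<in>?N. nabla_classical e j \<beta> (nabla_classical e k \<gamma> u) q * (omega {j} \<and>\<^sub>e omega {k}) J)" for j
  proof -
    have "?du I = (\<lambda>y. 0)" if "I \<in> Pow ?N - (\<lambda>k. {k}) ` ?N" for I
      using that by (auto simp: omega_def fun_eq_iff intro!: sum.neutral)
    then have "(\<Sum>I\<in>Pow ?N. nabla_classical e j \<beta> (?du I) q * (omega {j} \<and>\<^sub>e omega I) J)
        = (\<Sum>I\<in>(\<lambda>k. {k}) ` ?N. nabla_classical e j \<beta> (?du I) q * (omega {j} \<and>\<^sub>e omega I) J)"
      by (intro sum.mono_neutral_right) (auto simp: nabla_classical_const)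
    also have "\<dots> = (\<Sum>k\<in>?N. nabla_classical e j \<beta> (?du {k}) q * (omega {j} \<and>\<^sub>e omega {k}) J)"
      by (subst sum.reindex) (auto simp: inj_on_def)
    also have "\<dots> = (\<Sum>k\<in>?N. nabla_classical e j \<beta> (nabla_classical e k \<gamma> u) q * (omega {j} \<and>\<^sub>e omega {k}) J)"
    proof (rule sum.cong[OF refl])
      fix k assume "k \<in> ?N"
      have "?du {k} y = (\<Sum>l\<in>?N. if l = k then nabla_classical e k \<gamma> u y else 0)" for y
        by (intro sum.cong) (auto simp: omega_def)
      with \<open>k \<in> ?N\<close> have "?du {k} = nabla_classical e k \<gamma> u" by (simp add: fun_eq_iff)
      then show "nabla_classical e j \<beta> (?du {k}) q * (omega {j} \<and>\<^sub>e omega {k}) J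
          = nabla_classical e j \<beta> (nabla_classical e k \<gamma> u) q * (omega {j} \<and>\<^sub>e omega {k}) J"
        by simp
    qed
    finally show ?thesis .
  qed
  then show "d_classical e \<beta> (d_classical e \<gamma> (zero_form u)) q J
    = (\<Sum>j\<in>?N. \<Sum>k\<in>?N. nabla_classical e j \<beta> (nabla_classical e k \<gamma> u) q * (omega {j} \<and>\<^sub>e omega {k}) J)"
    unfolding outer d_zero_form by simp
qed

lemma d_d_anticommute:
  fixes e :: "nat \<Rightarrow> 'n::finite"
  assumes "open \<Omega>" "C_on 2 \<Omega> u" "q \<in> \<Omega>"
  shows "d_classical e \<beta> (d_classical e \<gamma> (zero_form u)) q
    = (\<lambda>J. - d_classical e \<gamma> (d_classical e \<beta> (zero_form u)) q J)"
proof
  fix J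
  let ?N = "{..<2 * CARD('n)}"
  have "d_classical e \<beta> (d_classical e \<gamma> (zero_form u)) q J
      = (\<Sum>j\<in>?N. \<Sum>k\<in>?N. - (nabla_classical e k \<gamma> (nabla_classical e j \<beta> u) q * (omega {k} \<and>\<^sub>e omega {j}) J))"
    unfolding d_d_zero_form
    by (intro sum.cong refl, subst nabla_classical_commute[OF assms], subst omega_anticommute) simp
  also have "\<dots> = - d_classical e \<gamma> (d_classical e \<beta> (zero_form u)) q J"
    by (subst sum.swap) (simp add: d_d_zero_form sum_negf)
  finally show "d_classical e \<beta> (d_classical e \<gamma> (zero_form u)) q J
      = - d_classical e \<gamma> (d_classical e \<beta> (zero_form u)) q J" .
qed

text \<open>
  Baston forms have degree two.  They therefore commute with all forms, which allows a new factor to be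
  put in front of the product.
\<close>

lemma baston_even: "baston e u q J \<noteq> 0 \<Longrightarrow> even (card J)"
proof -
  assume "baston e u q J \<noteq> 0"
  then obtain j k where "(omega {j} \<and>\<^sub>e omega {k}) J \<noteq> 0"
    unfolding baston_def d_d_zero_form by (metis (no_types, lifting) mult_zero_right sum.neutral)
  then have "j \<noteq> k" "J = {j, k}" by (auto simp: wedge_omega split: if_splits)
  then show "even (card J)" by simp
qed

section \<open>Weakly closed forms\<close>

definition continuous_form :: "'a::topological_space set \<Rightarrow> ('a \<Rightarrow> ext) \<Rightarrow> bool" where
  "continuous_form \<Omega> F \<longleftrightarrow> (\<forall>J. continuous_on \<Omega> (\<lambda>q. F q J))"

lemma continuous_form_wedge:
  "continuous_form \<Omega> F \<Longrightarrow> continuous_form \<Omega> G \<Longrightarrow> continuous_form \<Omega> (\<lambda>q. F q \<and>\<^sub>e G q)"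
  unfolding continuous_form_def wedge_def by (intro allI continuous_intros) auto

lemma continuous_form_const: "continuous_form \<Omega> (\<lambda>q. a)"
  by (simp add: continuous_form_def)

lemma continuous_form_baston: "C_on 2 \<Omega> u \<Longrightarrow> continuous_form \<Omega> (baston e u)"
  unfolding continuous_form_def baston_def d_d_zero_form
  by (intro allI continuous_intros nabla_classical_continuous nabla_classical_C1)

lemma continuous_form_omega_wedge:
  "continuous_form \<Omega> F \<Longrightarrow> continuous_on \<Omega> (\<lambda>q. (omega I \<and>\<^sub>e F q) J)"
  using continuous_form_wedge[OF continuous_form_const] unfolding continuous_form_def by blast

text \<open>
  Closedness is tested with \<open>C^1\<close> functions instead of smooth ones because the test functions
  \<open>\<nabla>\<^sub>i\<phi> \<nabla>\<^sub>ku\<close> that occur in the induction have no more regularity.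
\<close>

definition weakly_closed ::
    "(nat \<Rightarrow> 'n::finite) \<Rightarrow> 'n qspace set \<Rightarrow> nat \<Rightarrow> ('n qspace \<Rightarrow> ext) \<Rightarrow> bool" where
  "weakly_closed e \<Omega> \<alpha> F \<longleftrightarrow> (\<forall>\<phi> J. C_compact 1 \<Omega> \<phi> \<longrightarrow>
     (LINT q:\<Omega>|lborel. (d_classical e \<alpha> (zero_form \<phi>) q \<and>\<^sub>e F q) J) = 0)"

lemma set_integrable_d_wedge:
  assumes "C_compact 1 \<Omega> \<phi>" "continuous_form \<Omega> F"
  shows "set_integrable lborel \<Omega> (\<lambda>q. (d_classical e \<alpha> (zero_form \<phi>) q \<and>\<^sub>e F q) J)"
  unfolding d_zero_form_wedge
  by (intro set_integral_sum(1), subst mult.commute,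
      intro set_integrable_nabla_mult assms continuous_form_omega_wedge)

lemma integral_const_wedge_eq_0:
  assumes "\<And>J. set_integrable M A (\<lambda>x. F x J)" "\<And>J. (LINT x:A|M. F x J) = 0"
  shows "set_integrable M A (\<lambda>x. (a \<and>\<^sub>e F x) J)" "(LINT x:A|M. (a \<and>\<^sub>e F x) J) = 0"
  unfolding wedge_def using assms
  by (auto intro!: set_integral_sum(1) simp: set_integral_sum(2))

lemma sum_symmetric_antisymmetric:
  fixes s w :: "'i \<Rightarrow> 'i \<Rightarrow> complex"
  assumes "\<And>i j. s i j = s j i" "\<And>i j. w i j = - w j i"
  shows "(\<Sum>i\<in>S. \<Sum>j\<in>S. s i j * w i j) = 0"
proof -
  have "(\<Sum>i\<in>S. \<Sum>j\<in>S. s i j * w i j) = (\<Sum>i\<in>S. \<Sum>j\<in>S. - (s j i * w j i))"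
    by (intro sum.cong refl) (metis assms mult_minus_right)
  also have "\<dots> = - (\<Sum>i\<in>S. \<Sum>j\<in>S. s i j * w i j)"
    by (subst sum.swap) (simp add: sum_negf)
  finally show ?thesis by simp
qed

text \<open>
  This is \<open>d\<^sub>\<beta>\<phi> \<and> d\<^sub>\<beta>d\<^sub>\<gamma>u \<and> a = - d\<^sub>\<beta>(d\<^sub>\<beta>\<phi> \<and> d\<^sub>\<gamma>u) \<and> a\<close> with the derivative written on the
  scalar coefficients \<open>\<nabla>\<^sub>i\<^sub>\<beta>\<phi> \<nabla>\<^sub>k\<^sub>\<gamma>u\<close>.  In the product rule for these coefficients the terms with
  second derivatives of \<open>\<phi>\<close> cancel, as \<open>\<nabla>\<^sub>j\<^sub>\<beta>\<nabla>\<^sub>i\<^sub>\<beta>\<phi>\<close> is symmetric and \<open>\<omega>^i \<and> \<omega>^j\<close> antisymmetric in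
  \<open>i\<close> and \<open>j\<close>.
\<close>

lemma d_wedge_d_d:
  fixes e :: "nat \<Rightarrow> 'n::finite"
  assumes "open \<Omega>" "C_on 2 \<Omega> u" "C_on 2 \<Omega> \<phi>" "q \<in> \<Omega>"
  shows "(d_classical e \<beta> (zero_form \<phi>) q \<and>\<^sub>e
      (d_classical e \<beta> (d_classical e \<gamma> (zero_form u)) q \<and>\<^sub>e a)) J
    = - (\<Sum>i<2 * CARD('n). \<Sum>k<2 * CARD('n). (omega {i} \<and>\<^sub>e (omega {k} \<and>\<^sub>e
        (d_classical e \<beta> (zero_form (\<lambda>x. nabla_classical e i \<beta> \<phi> x * nabla_classical e k \<gamma> u x)) q \<and>\<^sub>e a))) J)"
proof -
  let ?N = "{..<2 * CARD('n)}"
  define p where "p i = nabla_classical e i \<beta> \<phi> q" for i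
  define pp where "pp j i = nabla_classical e j \<beta> (nabla_classical e i \<beta> \<phi>) q" for i j
  define v where "v k = nabla_classical e k \<gamma> u q" for k
  define vv where "vv j k = nabla_classical e j \<beta> (nabla_classical e k \<gamma> u) q" for j k
  define W where "W i j k = (omega {i} \<and>\<^sub>e (omega {j} \<and>\<^sub>e (omega {k} \<and>\<^sub>e a))) J" for i j k
  have W12: "W i j k = - W j i k" for i j k
    unfolding W_def by (subst omega_wedge_left_commute) (rule refl)
  have W23: "W i k j = - W i j k" for i j k
    unfolding W_def by (subst omega_wedge_left_commute[of k j]) (simp add: wedge_minus_right)
  have product: "nabla_classical e j \<beta> (\<lambda>x. nabla_classical e i \<beta> \<phi> x * nabla_classical e k \<gamma> u x) q
      = p i * vv j k + pp j i * v k" for i j k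
    unfolding p_def pp_def v_def vv_def
    using assms nabla_classical_C1 unfolding C_on_1 by (intro nabla_classical_mult) blast+
  have pp: "pp j i = pp i j" for i j
    unfolding pp_def by (rule nabla_classical_commute[OF assms(1,3,4)])
  have "(d_classical e \<beta> (zero_form \<phi>) q \<and>\<^sub>e
      (d_classical e \<beta> (d_classical e \<gamma> (zero_form u)) q \<and>\<^sub>e a)) J
      = (\<Sum>i\<in>?N. \<Sum>k\<in>?N. \<Sum>j\<in>?N. p i * vv j k * W i j k)"
  proof -
    have "d_classical e \<beta> (d_classical e \<gamma> (zero_form u)) q
        = (\<lambda>J. \<Sum>(j, k)\<in>?N \<times> ?N. vv j k * (omega {j} \<and>\<^sub>e omega {k}) J)"
      unfolding d_d_zero_form vv_def sum.cartesian_product ..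
    then have "(d_classical e \<beta> (zero_form \<phi>) q \<and>\<^sub>e
        (d_classical e \<beta> (d_classical e \<gamma> (zero_form u)) q \<and>\<^sub>e a)) J
        = (\<Sum>i\<in>?N. p i * (\<Sum>(j, k)\<in>?N \<times> ?N. vv j k * W i j k))"
      unfolding d_zero_form_wedge
      by (simp add: split_beta wedge_sum_left wedge_sum_right wedge_assoc W_def p_def)
    also have "\<dots> = (\<Sum>i\<in>?N. \<Sum>j\<in>?N. \<Sum>k\<in>?N. p i * vv j k * W i j k)"
      by (simp add: sum.cartesian_product[symmetric] sum_distrib_left mult.assoc)
    also have "\<dots> = (\<Sum>i\<in>?N. \<Sum>k\<in>?N. \<Sum>j\<in>?N. p i * vv j k * W i j k)"
      by (intro sum.cong refl sum.swap)
    finally show ?thesis .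
  qed
  moreover have "(\<Sum>i\<in>?N. \<Sum>k\<in>?N. (omega {i} \<and>\<^sub>e (omega {k} \<and>\<^sub>e
        (d_classical e \<beta> (zero_form (\<lambda>x. nabla_classical e i \<beta> \<phi> x * nabla_classical e k \<gamma> u x)) q \<and>\<^sub>e a))) J)
      = (\<Sum>i\<in>?N. \<Sum>k\<in>?N. \<Sum>j\<in>?N. (p i * vv j k + pp j i * v k) * W i k j)"
    unfolding d_zero_form wedge_sum_left wedge_sum_right product W_def ..
  moreover have "\<dots> = - (\<Sum>i\<in>?N. \<Sum>k\<in>?N. \<Sum>j\<in>?N. p i * vv j k * W i j k)
      - (\<Sum>i\<in>?N. \<Sum>k\<in>?N. \<Sum>j\<in>?N. pp j i * v k * W i j k)"
  proof -
    have "(p i * vv j k + pp j i * v k) * W i k j = - (p i * vv j k * W i j k) - pp j i * v k * W i j k"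
      for i j k
      using W23[of i k j] by (simp add: algebra_simps)
    then show ?thesis by (simp add: sum_negf sum_subtractf)
  qed
  moreover have "(\<Sum>i\<in>?N. \<Sum>k\<in>?N. \<Sum>j\<in>?N. pp j i * v k * W i j k) = 0"
  proof -
    have "(\<Sum>i\<in>?N. \<Sum>k\<in>?N. \<Sum>j\<in>?N. pp j i * v k * W i j k)
        = (\<Sum>k\<in>?N. \<Sum>i\<in>?N. \<Sum>j\<in>?N. pp j i * (v k * W i j k))"
      by (subst sum.swap) (simp add: mult.assoc)
    also have "\<dots> = 0"
      by (intro sum.neutral ballI sum_symmetric_antisymmetric pp) (subst W12, simp)
    finally show ?thesis .
  qed
  ultimately show ?thesis by simp
qed

lemma integral_d_wedge_d_d_eq_0:
  fixes e :: "nat \<Rightarrow> 'n::finite"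
  assumes "open \<Omega>" "continuous_form \<Omega> F" "weakly_closed e \<Omega> \<beta> F" "C_on 2 \<Omega> u" "C_compact 2 \<Omega> \<phi>"
  shows "(LINT q:\<Omega>|lborel. (d_classical e \<beta> (zero_form \<phi>) q \<and>\<^sub>e
      (d_classical e \<beta> (d_classical e \<gamma> (zero_form u)) q \<and>\<^sub>e F q)) J) = 0"
proof -
  obtain K where K: "compact K" "K \<subseteq> \<Omega>" "\<And>x. x \<notin> K \<Longrightarrow> \<phi> x = 0"
    using assms(5) unfolding C_compact_def by blast
  have C2: "C_on 2 UNIV \<phi>" using assms(5) unfolding C_compact_def by blast
  then have C2\<Omega>: "C_on 2 \<Omega> \<phi>"
    unfolding C_on_2 C_on_1 by (blast intro: continuous_on_subset)
  define \<psi> where "\<psi> i k = (\<lambda>x. nabla_classical e i \<beta> \<phi> x * nabla_classical e k \<gamma> u x)" for i k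
  \<comment> \<open>Outside \<open>\<Omega>\<close> nothing is known about \<open>u\<close>, but there the derivatives of \<open>\<phi>\<close> vanish.\<close>
  have \<psi>: "C_compact 1 \<Omega> (\<psi> i k)" for i k
  proof -
    have zero: "\<psi> i k x = 0" if "x \<notin> K" for x
      using nabla_classical_outside_compact[OF K(1) _ that, of \<phi>] K(3) by (simp add: \<psi>_def)
    have "C_on 1 \<Omega> (\<psi> i k)"
      unfolding \<psi>_def by (intro C_on_1_mult nabla_classical_C1 C2\<Omega> assms)
    moreover have "C_on 1 (- K) (\<psi> i k)"
      by (rule C_on_1_cong_open[OF _ _ C_on_1_const[of _ 0]])
         (use K(1) zero in \<open>auto dest: compact_imp_closed\<close>)
    ultimately have "C_on 1 (\<Omega> \<union> - K) (\<psi> i k)"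
      using assms(1) compact_imp_closed[OF K(1)] unfolding C_on_1
      by (auto intro!: continuous_on_open_Un)
    moreover have "\<Omega> \<union> - K = UNIV" using K(2) by auto
    ultimately show ?thesis
      unfolding C_compact_def using K zero by metis
  qed
  let ?G = "\<lambda>i k q. omega {i} \<and>\<^sub>e (omega {k} \<and>\<^sub>e (d_classical e \<beta> (zero_form (\<psi> i k)) q \<and>\<^sub>e F q))"
  have int: "set_integrable lborel \<Omega> (\<lambda>q. (d_classical e \<beta> (zero_form (\<psi> i k)) q \<and>\<^sub>e F q) J)"
    and zero: "(LINT q:\<Omega>|lborel. (d_classical e \<beta> (zero_form (\<psi> i k)) q \<and>\<^sub>e F q) J) = 0" for i k J
    using set_integrable_d_wedge[OF \<psi> assms(2)] assms(3) \<psi> unfolding weakly_closed_def by blast+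
  have G: "set_integrable lborel \<Omega> (\<lambda>q. ?G i k q J)" "(LINT q:\<Omega>|lborel. ?G i k q J) = 0" for i k
    by (intro integral_const_wedge_eq_0 int zero)+
  have "(LINT q:\<Omega>|lborel. (d_classical e \<beta> (zero_form \<phi>) q \<and>\<^sub>e
      (d_classical e \<beta> (d_classical e \<gamma> (zero_form u)) q \<and>\<^sub>e F q)) J)
      = (LINT q:\<Omega>|lborel. (- 1) * (\<Sum>i<2 * CARD('n). \<Sum>k<2 * CARD('n). ?G i k q J))"
    using assms(1) d_wedge_d_d[OF assms(1,4) C2\<Omega>, of _ e \<beta> \<gamma>, folded \<psi>_def]
    by (intro set_lebesgue_integral_cong) auto
  also have "\<dots> = 0"
    unfolding set_integral_mult_right
    using G by (simp add: set_integral_sum)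
  finally show ?thesis .
qed

lemma weakly_closedI_C2:
  fixes e :: "nat \<Rightarrow> 'n::finite"
  assumes "open \<Omega>" "continuous_form \<Omega> F"
    and "\<And>\<phi> J. C_compact 2 \<Omega> \<phi> \<Longrightarrow> (LINT q:\<Omega>|lborel. (d_classical e \<alpha> (zero_form \<phi>) q \<and>\<^sub>e F q) J) = 0"
  shows "weakly_closed e \<Omega> \<alpha> F"
  unfolding weakly_closed_def
proof (intro allI impI)
  fix \<phi> :: "'n qspace \<Rightarrow> complex" and J assume \<phi>: "C_compact 1 \<Omega> \<phi>"
  define S where "S = {..<2 * CARD('n)} \<times> {0, 1::nat}"
  define w where "w = (\<lambda>(k, s) q. nabla_coeff k \<alpha> s * (omega {k} \<and>\<^sub>e F q) J)"
  define c where "c = (\<lambda>(k, s). coord_vec e (nabla_index k \<alpha> + s))"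
  have w: "continuous_on \<Omega> (w i)" for i
    unfolding w_def by (cases i)
      (auto intro!: continuous_intros continuous_form_omega_wedge assms)
  have c: "c i \<in> Basis" for i
    unfolding c_def by (cases i) (simp add: coord_vec_Basis)
  have eq: "(LINT q:\<Omega>|lborel. (d_classical e \<alpha> (zero_form \<phi>) q \<and>\<^sub>e F q) J)
      = (\<Sum>i\<in>S. LINT q:\<Omega>|lborel. w i q * dir_deriv (c i) \<phi> q)" if "C_compact 1 \<Omega> \<phi>" for \<phi>
  proof -
    have "(d_classical e \<alpha> (zero_form \<phi>) q \<and>\<^sub>e F q) J = (\<Sum>i\<in>S. w i q * dir_deriv (c i) \<phi> q)" for q
    proof -
      have "(\<Sum>i\<in>S. g i) = (\<Sum>k<2 * CARD('n). g (k, 0) + g (k, 1))" for g :: "nat \<times> nat \<Rightarrow> complex"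
        using sum.cartesian_product[of "\<lambda>k s. g (k, s)" "{0, 1}" "{..<2 * CARD('n)}"]
        by (simp add: S_def split_beta)
      then show ?thesis
        unfolding d_zero_form_wedge nabla_eq by (simp add: w_def c_def algebra_simps)
    qed
    then show ?thesis
      using C_compact_set_integrable[OF that w c] by (simp add: set_integral_sum(2))
  qed
  show "(LINT q:\<Omega>|lborel. (d_classical e \<alpha> (zero_form \<phi>) q \<and>\<^sub>e F q) J) = 0"
    unfolding eq[OF \<phi>]
  proof (rule vanishes_on_C1_if_on_C2[OF assms(1) w c _ \<phi>])
    fix \<phi> :: "'n qspace \<Rightarrow> complex" assume "C_compact 2 \<Omega> \<phi>"
    moreover from this have "C_compact 1 \<Omega> \<phi>"
      using C_on_2_imp_1 unfolding C_compact_def by blast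
    ultimately show "(\<Sum>i\<in>S. LINT q:\<Omega>|lborel. w i q * dir_deriv (c i) \<phi> q) = 0"
      using assms(3) by (simp flip: eq)
  qed
qed

text \<open>
  For \<open>\<alpha> = 0\<close> the identity above applies to \<open>\<triangle>u = d\<^sub>0d\<^sub>1u\<close> directly, for \<open>\<alpha> = 1\<close> to
  \<open>\<triangle>u = - d\<^sub>1d\<^sub>0u\<close>: the derivative on \<open>\<phi>\<close> and the outer one on \<open>u\<close> have to carry the same index.
\<close>

lemma weakly_closed_baston_wedge:
  fixes e :: "nat \<Rightarrow> 'n::finite"
  assumes "open \<Omega>" "continuous_form \<Omega> F" "weakly_closed e \<Omega> 0 F" "weakly_closed e \<Omega> 1 F" "C_on 2 \<Omega> u"
  shows "weakly_closed e \<Omega> 0 (\<lambda>q. baston e u q \<and>\<^sub>e F q)" "weakly_closed e \<Omega> 1 (\<lambda>q. baston e u q \<and>\<^sub>e F q)"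
proof -
  have cont: "continuous_form \<Omega> (\<lambda>q. baston e u q \<and>\<^sub>e F q)"
    by (intro continuous_form_wedge continuous_form_baston assms)
  show "weakly_closed e \<Omega> 0 (\<lambda>q. baston e u q \<and>\<^sub>e F q)"
    by (rule weakly_closedI_C2[OF assms(1) cont])
       (simp add: baston_def integral_d_wedge_d_d_eq_0[OF assms(1,2,3,5)])
  show "weakly_closed e \<Omega> 1 (\<lambda>q. baston e u q \<and>\<^sub>e F q)"
  proof (rule weakly_closedI_C2[OF assms(1) cont])
    fix \<phi> :: "'n qspace \<Rightarrow> complex" and J assume \<phi>: "C_compact 2 \<Omega> \<phi>"
    have "(LINT q:\<Omega>|lborel. (d_classical e 1 (zero_form \<phi>) q \<and>\<^sub>e (baston e u q \<and>\<^sub>e F q)) J)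
        = (LINT q:\<Omega>|lborel. (- 1) * (d_classical e 1 (zero_form \<phi>) q \<and>\<^sub>e
            (d_classical e 1 (d_classical e 0 (zero_form u)) q \<and>\<^sub>e F q)) J)"
      using assms(1)
      by (intro set_lebesgue_integral_cong)
         (auto simp: baston_def d_d_anticommute[OF assms(1,5), of _ e 0] wedge_minus_left wedge_minus_right)
    then show "(LINT q:\<Omega>|lborel. (d_classical e 1 (zero_form \<phi>) q \<and>\<^sub>e (baston e u q \<and>\<^sub>e F q)) J) = 0"
      unfolding set_integral_mult_right
      by (simp only: integral_d_wedge_d_d_eq_0[OF assms(1,2,4,5) \<phi>] mult_zero_right)
  qed
qed

lemma weakly_closed_omega_empty:
  fixes e :: "nat \<Rightarrow> 'n::finite"
  shows "weakly_closed e \<Omega> \<alpha> (\<lambda>q. omega {})"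
  unfolding weakly_closed_def
proof (intro allI impI)
  fix \<phi> :: "'n qspace \<Rightarrow> complex" and J assume \<phi>: "C_compact 1 \<Omega> \<phi>"
  have int: "set_integrable lborel \<Omega> (\<lambda>q. c * dir_deriv (coord_vec e i) \<phi> q)" for i c
    by (rule C_compact_set_integrable[OF \<phi> continuous_on_const coord_vec_Basis])
  have "(LINT q:\<Omega>|lborel. nabla_classical e k \<alpha> \<phi> q) = 0" for k
    unfolding nabla_eq
    using int by (simp add: set_integral_add integral_dir_deriv_eq_0[OF \<phi> coord_vec_Basis])
  moreover have "set_integrable lborel \<Omega> (\<lambda>q. omega {k} J * nabla_classical e k \<alpha> \<phi> q)" for k
    by (rule set_integrable_nabla_mult[OF \<phi> continuous_on_const])
  ultimately show "(LINT q:\<Omega>|lborel. (d_classical e \<alpha> (zero_form \<phi>) q \<and>\<^sub>e omega {}) J) = 0"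
    unfolding d_zero_form_wedge wedge_omega_empty
    by (simp add: set_integral_sum mult.commute[of _ "omega _ J"])
qed

lemma weakly_closed_wedge_upto:
  fixes e :: "nat \<Rightarrow> 'n::finite"
  assumes "open \<Omega>" "\<And>i. i \<in> {1..k} \<Longrightarrow> C_on 2 \<Omega> (u i)"
  defines "F \<equiv> wedge_upto (\<lambda>i. baston e (u i)) k"
  shows "continuous_form \<Omega> F \<and> weakly_closed e \<Omega> 0 F \<and> weakly_closed e \<Omega> 1 F"
  using assms(2) unfolding F_def
proof (induction k)
  case 0
  then show ?case
    by (simp add: continuous_form_const weakly_closed_omega_empty)
next
  case (Suc k)
  then have IH: "continuous_form \<Omega> (wedge_upto (\<lambda>i. baston e (u i)) k)"
    "weakly_closed e \<Omega> 0 (wedge_upto (\<lambda>i. baston e (u i)) k)"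
    "weakly_closed e \<Omega> 1 (wedge_upto (\<lambda>i. baston e (u i)) k)" and u: "C_on 2 \<Omega> (u (Suc k))"
    by auto
  have "wedge_upto (\<lambda>i. baston e (u i)) (Suc k)
      = (\<lambda>q. baston e (u (Suc k)) q \<and>\<^sub>e wedge_upto (\<lambda>i. baston e (u i)) k q)"
    by (simp add: wedge_commute_even[OF baston_even])
  then show ?case
    using weakly_closed_baston_wedge[OF assms(1) IH u]
      continuous_form_wedge[OF continuous_form_baston[OF u] IH(1)] by simp
qed

text \<open>
  Up to sign, the distributional \<open>d\<^sub>\<alpha> F\<close> applied to \<open>\<phi>\<close> is the integral of \<open>d\<^sub>\<alpha>\<phi> \<and> F\<close>, at least at
  the indices \<open>J \<subseteq> {..<2n}\<close>; at all other \<open>J\<close> the products \<open>\<omega>^k \<and> \<omega>^I\<close> have coefficient \<open>0\<close>.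
\<close>

lemma d_distr_vanishes_if_weakly_closed:
  fixes e :: "nat \<Rightarrow> 'n::finite"
  assumes "continuous_form \<Omega> F" "weakly_closed e \<Omega> \<alpha> F"
  shows "d_distr_vanishes e \<Omega> \<alpha> F"
  unfolding d_distr_vanishes_def
proof (intro ballI allI)
  fix \<phi> :: "'n qspace \<Rightarrow> complex" and J assume "\<phi> \<in> test_functions \<Omega>"
  then have C: "C_on 1 UNIV \<phi>" and supp: "compact (closure {q. \<phi> q \<noteq> 0})" "closure {q. \<phi> q \<noteq> 0} \<subseteq> \<Omega>"
    unfolding test_functions_def by blast+
  moreover have "\<phi> x = 0" if "x \<notin> closure {q. \<phi> q \<noteq> 0}" for x
    using that closure_subset[of "{q. \<phi> q \<noteq> 0}"] by blast
  ultimately have \<phi>: "C_compact 1 \<Omega> \<phi>" unfolding C_compact_def by blast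
  let ?N = "{..<2 * CARD('n)}"
  have F: "continuous_on \<Omega> (\<lambda>q. F q I)" for I using assms(1) by (simp add: continuous_form_def)
  have "set_integrable lborel \<Omega> (\<lambda>q. F q I * dir_deriv (coord_vec e i) \<phi> q)" for I i
    by (rule C_compact_set_integrable[OF \<phi> F coord_vec_Basis])
  moreover have "(\<lambda>q. F q I * nabla_classical e k \<alpha> \<phi> q)
      = (\<lambda>q. nabla_coeff k \<alpha> 0 * (F q I * dir_deriv (coord_vec e (nabla_index k \<alpha>)) \<phi> q)
           + nabla_coeff k \<alpha> 1 * (F q I * dir_deriv (coord_vec e (nabla_index k \<alpha> + 1)) \<phi> q))" for k I
    by (simp add: nabla_eq fun_eq_iff algebra_simps)
  ultimately have parts: "nabla (distr_partial e) k \<alpha> (\<lambda>\<psi>. form_distribution \<Omega> F \<psi> I) \<phi>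
      = - (LINT q:\<Omega>|lborel. F q I * nabla_classical e k \<alpha> \<phi> q)" for k I
    by (simp add: nabla_eq[of "distr_partial e"] distr_partial_def form_distribution_def set_integral_add)
  have int: "set_integrable lborel \<Omega> (\<lambda>q. F q I * nabla_classical e k \<alpha> \<phi> q * c)" for I k c
    using set_integrable_nabla_mult[OF \<phi> F] by simp
  have "d_distr e \<Omega> \<alpha> F \<phi> J = (\<Sum>k\<in>?N. \<Sum>I\<in>Pow ?N.
      - (LINT q:\<Omega>|lborel. F q I * nabla_classical e k \<alpha> \<phi> q * (omega {k} \<and>\<^sub>e omega I) J))"
    by (simp add: d_distr_def d_gen_def parts)
  also have "\<dots> = - (LINT q:\<Omega>|lborel. \<Sum>k\<in>?N. \<Sum>I\<in>Pow ?N.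
      F q I * nabla_classical e k \<alpha> \<phi> q * (omega {k} \<and>\<^sub>e omega I) J)"
    using int by (simp add: set_integral_sum sum_negf del: set_integral_mult_left)
  also have "\<dots> = 0"
  proof (cases "J \<subseteq> ?N")
    case True
    have "(\<Sum>k\<in>?N. \<Sum>I\<in>Pow ?N. F q I * nabla_classical e k \<alpha> \<phi> q * (omega {k} \<and>\<^sub>e omega I) J)
        = (d_classical e \<alpha> (zero_form \<phi>) q \<and>\<^sub>e F q) J" for q
      unfolding d_zero_form_wedge unfolding wedge_eq_sum_omega[OF finite_lessThan True, of _ "F q"]
      by (simp add: sum_distrib_left mult_ac)
    then show ?thesis using assms(2) \<phi> by (simp add: weakly_closed_def)
  next
    case False
    then have "(omega {k} \<and>\<^sub>e omega I) J = 0" if "k \<in> ?N" "I \<in> Pow ?N" for k I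
      using that by (auto simp: wedge_omega)
    then show ?thesis by (simp add: set_lebesgue_integral_def)
  qed
  finally show "d_distr e \<Omega> \<alpha> F \<phi> J = 0" .
qed

theorem corollary2p1:
  fixes e :: "nat \<Rightarrow> 'n::finite"
    and \<Omega> :: "'n qspace set"
    and u :: "nat \<Rightarrow> 'n qspace \<Rightarrow> complex"
    and k :: nat
  assumes "bij_betw e {..<CARD('n)} UNIV"
    and "open \<Omega>" and "connected \<Omega>" and "\<Omega> \<noteq> {}"
    and "\<And>i. i \<in> {1..CARD('n)} \<Longrightarrow> C_on 2 \<Omega> (u i)"
    and "k \<in> {1..CARD('n)}"
  shows "d_distr_vanishes e \<Omega> 0 (wedge_upto (\<lambda>i. baston e (u i)) k)
       \<and> d_distr_vanishes e \<Omega> 1 (wedge_upto (\<lambda>i. baston e (u i)) k)"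
proof -
  have "C_on 2 \<Omega> (u i)" if "i \<in> {1..k}" for i
    using that assms(5,6) by auto
  then have "continuous_form \<Omega> (wedge_upto (\<lambda>i. baston e (u i)) k)
      \<and> weakly_closed e \<Omega> 0 (wedge_upto (\<lambda>i. baston e (u i)) k)
      \<and> weakly_closed e \<Omega> 1 (wedge_upto (\<lambda>i. baston e (u i)) k)"
    by (rule weakly_closed_wedge_upto[OF assms(2)])
  then show ?thesis
    using d_distr_vanishes_if_weakly_closed by blast
qed

end
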